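(* For each integer $r \ge 2$, there exists $\delta = \delta(r) > 0$ such that $$R_r(k) \le e^{-\delta k} r^{rk}$$ for all sufficiently large $k \in \mathbb{N}$.
   Context: For $r,k \in \mathbb{N}$, the $r$-colour Ramsey number $R_r(k)$ is the minimum $n \in \mathbb{N}$ such that every colouring of the edges of the complete graph $K_n$ with $r$ colours contains a monochromatic copy of $K_k$. *)

theory Defs
  imports Complex_Main "HOL-Library.Ramsey"
begin

text \<open>
  The complete graph on \<open>n\<close> vertices has vertex set \<open>{..<n}\<close> and edge set \<open>nsets {..<n} 2\<close>;
  \<open>partn {..<n} k 2 {..<r}\<close> says that for every map from these edges to the colours \<open>{..<r}\<close>
  there is a colour class containing all pairs from some \<open>k\<close>-element vertex set.
\<close>
definition ramsey_number :: "nat \<Rightarrow> nat \<Rightarrow> nat"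
  where "ramsey_number r k = (LEAST n. partn {..<n} k 2 {..<r})"

text \<open>By Ramsey's theorem the minimum exists, so \<open>LEAST\<close> is not a junk value.\<close>
lemma partn_ramsey_number:
  "partn {..<ramsey_number r k} k 2 {..<r}"
proof -
  obtain N :: nat where "partn_lst {..<N} (replicate r k) 2"
    using ramsey_full by blast
  then have "partn {..<N} k 2 {..<r}"
    by (force simp: partn_lst_def partn_def)
  then show ?thesis
    unfolding ramsey_number_def by (rule LeastI)
qed

end

theory Submission
  imports Defs "HOL-Real_Asymp.Real_Asymp"
begin

text \<open>
  The argument is the multicolour book algorithm of Balister, Bollobas, Campos, Griffiths, Hurley,
  Morris, Sahasrabudhe and Tiba. First pass to a vertex subset in which every colour degree is at
  least about \<open>1/r\<close>; each step of this process that is forced by a low degree gains a factor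
  \<open>1 + \<epsilon>\<close> over the Erdos--Szekeres bound, so it may be assumed to stop early. In the regular set
  grow books \<open>(T i, Y i)\<close> in all colours simultaneously from a common reservoir \<open>X\<close>. A geometric
  lemma on \<open>r\<close> positive definite kernels gives a vertex \<open>x\<close> and a large part of \<open>X\<close> whose
  neighbourhoods correlate with those of \<open>x\<close> about as expected in every colour, unless in some
  colour they correlate much better, in which case restricting to \<open>Y i \<inter> N i x\<close> boosts the density
  there. This yields a monochromatic book with \<open>t = \<Theta>(k)\<close> spine vertices in colour \<open>i\<close> and about
  \<open>n / r^t\<close> pages. Since colour \<open>i\<close> now needs only \<open>k - t\<close> further vertices, the Erdos--Szekeres bound
  with unequal colour weights saves a factor \<open>exp (- c t\<^sup>2 / k)\<close>, more than the book construction lost.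
\<close>

section \<open>Positive definite kernels\<close>

text \<open>The proof is shaped by a competition of rates. Each spine vertex costs the reservoir a
  constant factor, so \<open>t\<close> is only a small multiple of \<open>k\<close>, and the final
  saving per spine vertex, of order \<open>t / (r * k)\<close>, is a small constant. Beyond the
  expected factor \<open>r\<close>, the pages must lose less than that. A boost costs them roughly a
  further factor \<open>r\<close>, so boosts must be much rarer than spine vertices. Hence only a
  level m \<ge> \<kappa> counts as a boost: it multiplies the density excess by at least 1 +
  \<kappa>^2 / (12 r t), and since the excess can grow only from about \<delta> to 1, there are O(t
  log(1/\<delta>) / \<kappa>^2) boosts. The reservoir pays for this threshold only about linearly in
  \<kappa>, because a correlation of size m^2 is found with frequency at least exp (- C (m + 1)) for
  some m; a square in the correlation against a linear exponent is exactly what the growth rate of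
  \<open>cosh_sqrt\<close> provides.\<close>

text \<open>The entire function \<open>\<Sum>n. x^n / (2n)!\<close>: nonnegative Taylor coefficients make it preserve positive
  definiteness, yet it is bounded on the negative axis.\<close>
definition cosh_sqrt :: "real \<Rightarrow> real"
  where "cosh_sqrt x = (if 0 \<le> x then cosh (sqrt x) else cos (sqrt (- x)))"

lemma sums_even_indices:
  fixes f :: "nat \<Rightarrow> real"
  assumes "(\<lambda>n. if even n then f n else 0) sums s"
  shows "(\<lambda>n. f (2 * n)) sums s"
proof -
  have "(\<lambda>n. sum (\<lambda>n. if even n then f n else 0) {n * 2..<n * 2 + 2}) sums s"
    by (rule sums_group[OF assms]) simp
  moreover have "sum (\<lambda>n. if even n then f n else 0) {n * 2..<n * 2 + 2} = f (2 * n)" for n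
  proof -
    have "{n * 2..<n * 2 + 2} = {2 * n, Suc (2 * n)}" by auto
    then show ?thesis by simp
  qed
  ultimately show ?thesis by simp
qed

lemma cosh_sqrt_sums: "(\<lambda>n. x ^ n / fact (2 * n)) sums cosh_sqrt x"
proof (cases "0 \<le> x")
  case True
  have "(\<lambda>n. sqrt x ^ (2 * n) /\<^sub>R fact (2 * n)) sums cosh (sqrt x)"
    by (rule sums_even_indices[OF cosh_converges])
  moreover have "sqrt x ^ (2 * n) /\<^sub>R fact (2 * n) = x ^ n / fact (2 * n)" for n
    unfolding power_mult real_sqrt_pow2[OF True] by (simp add: field_simps)
  ultimately show ?thesis
    using True by (simp add: cosh_sqrt_def)
next
  case False
  then have "(-1) ^ n * sqrt (- x) ^ (2 * n) = x ^ n" for n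
    by (simp add: power_mult power_mult_distrib[symmetric])
  then have "(-1) ^ n / fact (2 * n) * sqrt (- x) ^ (2 * n) = x ^ n / fact (2 * n)" for n
    by (simp add: field_simps)
  then show ?thesis
    using cos_paired[of "sqrt (- x)"] False by (simp add: cosh_sqrt_def)
qed

lemma cosh_sqrt_ge: "-1 \<le> cosh_sqrt x"
  by (smt (verit) cosh_real_ge_1 cos_ge_minus_one cosh_sqrt_def)

lemma cosh_sqrt_le_1: "x < 0 \<Longrightarrow> cosh_sqrt x \<le> 1"
  by (simp add: cosh_sqrt_def)

lemma cosh_sqrt_ge_linear:
  assumes "0 \<le> x"
  shows "1 + x / 2 \<le> cosh_sqrt x"
proof -
  have "(\<Sum>n<2. x ^ n / fact (2 * n)) \<le> (\<Sum>n. x ^ n / fact (2 * n))"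
    using assms by (intro sum_le_suminf sums_summable[OF cosh_sqrt_sums]) auto
  then show ?thesis
    using sums_unique[OF cosh_sqrt_sums[of x]] by (simp add: numeral_2_eq_2)
qed

lemma cosh_sqrt_le_exp: "cosh_sqrt x \<le> exp (sqrt (max x 0))"
proof (cases "0 \<le> x")
  case True
  then have "exp (- sqrt x) \<le> exp (sqrt x)" by simp
  then show ?thesis using True by (simp add: cosh_sqrt_def cosh_def)
next
  case False
  then show ?thesis using cosh_sqrt_le_1[of x] by simp
qed

section \<open>Positive semidefinite kernels and their multipliers\<close>

definition psd :: "'a set \<Rightarrow> ('a \<Rightarrow> 'a \<Rightarrow> real) \<Rightarrow> bool"
  where "psd X L \<longleftrightarrow> (\<forall>g. 0 \<le> (\<Sum>x\<in>X. \<Sum>y\<in>X. g x * g y * L x y))"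

text \<open>For symmetric kernels this is equivalent to \<^const>\<open>psd\<close> (Schur); as a definition it makes closure under
  products trivial.\<close>
definition psd_multiplier :: "'a set \<Rightarrow> ('a \<Rightarrow> 'a \<Rightarrow> real) \<Rightarrow> bool"
  where "psd_multiplier X K \<longleftrightarrow> (\<forall>L. psd X L \<longrightarrow> psd X (\<lambda>x y. K x y * L x y))"

lemma psd_one: "psd X (\<lambda>x y. 1)"
proof -
  have "(\<Sum>x\<in>X. \<Sum>y\<in>X. g x * g y * 1) = (\<Sum>x\<in>X. g x)\<^sup>2" for g :: "'a \<Rightarrow> real"
    by (simp add: power2_eq_square sum_product)
  then show ?thesis by (simp add: psd_def)
qed

text \<open>Multiplying the all-ones kernel shows that \<open>K\<close> itself is positive
  semidefinite; the sum is its quadratic form at the constant vector 1.\<close>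

lemma psd_multiplier_sum_nonneg:
  assumes "psd_multiplier X K"
  shows "0 \<le> (\<Sum>x\<in>X. \<Sum>y\<in>X. K x y)"
proof -
  have "psd X (\<lambda>x y. K x y * 1)"
    using assms psd_one psd_multiplier_def by blast
  then show ?thesis
    unfolding psd_def by (drule_tac spec[of _ "\<lambda>_. 1"]) simp
qed

lemma psd_multiplier_const: "0 \<le> c \<Longrightarrow> psd_multiplier X (\<lambda>x y. c)"
  unfolding psd_multiplier_def psd_def
  by (simp add: mult.left_commute[of _ c] sum_distrib_left[symmetric])

lemma psd_multiplier_add:
  "psd_multiplier X K \<Longrightarrow> psd_multiplier X K' \<Longrightarrow> psd_multiplier X (\<lambda>x y. K x y + K' x y)"
  unfolding psd_multiplier_def psd_def
  by (simp add: distrib_left distrib_right sum.distrib)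

lemma psd_multiplier_sum:
  "(\<And>i. i \<in> I \<Longrightarrow> psd_multiplier X (K i)) \<Longrightarrow> psd_multiplier X (\<lambda>x y. \<Sum>i\<in>I. K i x y)"
  by (induction I rule: infinite_finite_induct)
    (auto intro: psd_multiplier_add psd_multiplier_const)

lemma psd_multiplier_mult:
  assumes "psd_multiplier X K" "psd_multiplier X K'"
  shows "psd_multiplier X (\<lambda>x y. K x y * K' x y)"
  using assms unfolding psd_multiplier_def by (simp add: mult.assoc)

lemma psd_multiplier_prod:
  "(\<And>i. i \<in> I \<Longrightarrow> psd_multiplier X (K i)) \<Longrightarrow> psd_multiplier X (\<lambda>x y. \<Prod>i\<in>I. K i x y)"
  by (induction I rule: infinite_finite_induct)
    (auto intro: psd_multiplier_mult psd_multiplier_const)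

lemma psd_multiplier_LIMSEQ:
  assumes K: "\<And>n. psd_multiplier X (K n)"
    and lim: "\<And>x y. (\<lambda>n. K n x y) \<longlonglongrightarrow> K' x y"
  shows "psd_multiplier X K'"
  unfolding psd_multiplier_def psd_def
proof (intro allI impI)
  fix L :: "'a \<Rightarrow> 'a \<Rightarrow> real" and g :: "'a \<Rightarrow> real"
  assume L: "\<forall>g. 0 \<le> (\<Sum>x\<in>X. \<Sum>y\<in>X. g x * g y * L x y)"
  have "(\<lambda>n. \<Sum>x\<in>X. \<Sum>y\<in>X. g x * g y * (K n x y * L x y))
      \<longlonglongrightarrow> (\<Sum>x\<in>X. \<Sum>y\<in>X. g x * g y * (K' x y * L x y))"
    by (intro tendsto_intros lim)
  moreover have "0 \<le> (\<Sum>x\<in>X. \<Sum>y\<in>X. g x * g y * (K n x y * L x y))" for n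
    using K[of n] L unfolding psd_multiplier_def psd_def by blast
  ultimately show "0 \<le> (\<Sum>x\<in>X. \<Sum>y\<in>X. g x * g y * (K' x y * L x y))"
    by (intro LIMSEQ_le_const) auto
qed

text \<open>A rank-one factor \<open>s x v * s y v\<close> is absorbed into the test vector
  \<open>g\<close>.\<close>

lemma psd_multiplier_gram:
  "psd_multiplier X (\<lambda>x y. \<Sum>v\<in>Y. s x v * s y v)"
proof (rule psd_multiplier_sum)
  fix v
  show "psd_multiplier X (\<lambda>x y. s x v * s y v)"
    unfolding psd_multiplier_def psd_def
  proof (intro allI impI)
    fix L :: "'a \<Rightarrow> 'a \<Rightarrow> real" and g
    assume "\<forall>g. 0 \<le> (\<Sum>x\<in>X. \<Sum>y\<in>X. g x * g y * L x y)"
    then have "0 \<le> (\<Sum>x\<in>X. \<Sum>y\<in>X. (g x * s x v) * (g y * s y v) * L x y)"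
      by (rule spec)
    then show "0 \<le> (\<Sum>x\<in>X. \<Sum>y\<in>X. g x * g y * (s x v * s y v * L x y))"
      by (simp add: mult_ac)
  qed
qed

lemma psd_multiplier_cosh_sqrt:
  assumes "psd_multiplier X K"
  shows "psd_multiplier X (\<lambda>x y. cosh_sqrt (K x y))"
proof (rule psd_multiplier_LIMSEQ)
  fix n
  have "psd_multiplier X (\<lambda>x y. K x y ^ k)" for k
    by (induction k) (auto intro: psd_multiplier_mult psd_multiplier_const assms)
  then show "psd_multiplier X (\<lambda>x y. \<Sum>k<n. 1 / fact (2 * k) * K x y ^ k)"
    by (intro psd_multiplier_sum psd_multiplier_mult psd_multiplier_const) simp_all
next
  fix x y
  show "(\<lambda>n. \<Sum>k<n. 1 / fact (2 * k) * K x y ^ k) \<longlonglongrightarrow> cosh_sqrt (K x y)"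
    using cosh_sqrt_sums[of "K x y"] by (simp add: sums_def)
qed

text \<open>Nonnegative on average over Gram kernels, but at most \<open>-1\<close> once some argument is below \<open>-6r\<close>.\<close>
definition test_fun :: "nat \<Rightarrow> (nat \<Rightarrow> real) \<Rightarrow> real"
  where "test_fun r z = (\<Sum>j<r. z j * (\<Prod>i\<in>{..<r} - {j}. 2 + cosh_sqrt (z i)))"

text \<open>Since \<open>2 + cosh_sqrt\<close> is at least 1, the product factored out is positive,
  and the sign of \<open>test_fun\<close> is that of a sum of one-variable quotients. Each quotient
  is at most 2, however large its argument, while a negative argument contributes linearly; so one
  very negative colour outweighs all the others.\<close>

lemma test_fun_eq:
  "test_fun r z = (\<Prod>i<r. 2 + cosh_sqrt (z i)) * (\<Sum>j<r. z j / (2 + cosh_sqrt (z j)))"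
proof -
  have "(\<Prod>i<r. 2 + cosh_sqrt (z i)) = (2 + cosh_sqrt (z j)) * (\<Prod>i\<in>{..<r} - {j}. 2 + cosh_sqrt (z i))"
    if "j < r" for j
    using that by (simp add: prod.remove)
  moreover have "2 + cosh_sqrt (z j) \<noteq> 0" for j
    using cosh_sqrt_ge[of "z j"] by linarith
  ultimately show ?thesis
    unfolding test_fun_def sum_distrib_left by (intro sum.cong) auto
qed

lemma div_cosh_sqrt_le: "x / (2 + cosh_sqrt x) \<le> 2"
  using cosh_sqrt_ge_linear[of x] cosh_sqrt_ge[of x]
  by (cases "0 \<le> x") (auto simp: divide_le_eq)

lemma div_cosh_sqrt_le_neg:
  assumes "x < 0"
  shows "x / (2 + cosh_sqrt x) \<le> x / 3"
  using cosh_sqrt_le_1[OF assms] cosh_sqrt_ge[of x] assms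
  by (intro divide_left_mono_neg) (auto intro: mult_pos_pos)

lemma test_fun_le:
  "test_fun r z \<le> 2 * real r * 3 ^ r * exp (\<Sum>i<r. sqrt (max (z i) 0))"
proof -
  have 1: "0 \<le> 2 + cosh_sqrt (z i)" "2 + cosh_sqrt (z i) \<le> 3 * exp (sqrt (max (z i) 0))" for i
  proof -
    show "0 \<le> 2 + cosh_sqrt (z i)"
      using cosh_sqrt_ge[of "z i"] by simp
    have "1 \<le> exp (sqrt (max (z i) 0))" by simp
    then show "2 + cosh_sqrt (z i) \<le> 3 * exp (sqrt (max (z i) 0))"
      using cosh_sqrt_le_exp[of "z i"] by linarith
  qed
  have "(\<Prod>i<r. 2 + cosh_sqrt (z i)) \<le> (\<Prod>i<r. 3 * exp (sqrt (max (z i) 0)))"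
    using 1 by (intro prod_mono) auto
  also have "\<dots> = 3 ^ r * exp (\<Sum>i<r. sqrt (max (z i) 0))"
    by (simp add: prod.distrib exp_sum)
  finally have 2: "(\<Prod>i<r. 2 + cosh_sqrt (z i)) \<le> 3 ^ r * exp (\<Sum>i<r. sqrt (max (z i) 0))" .
  have 3: "(\<Sum>j<r. z j / (2 + cosh_sqrt (z j))) \<le> (\<Sum>j<r. 2)"
    by (intro sum_mono div_cosh_sqrt_le)
  have "test_fun r z \<le> (\<Prod>i<r. 2 + cosh_sqrt (z i)) * (2 * r)"
    unfolding test_fun_eq using 1 3 by (intro mult_left_mono prod_nonneg) (auto simp: mult.commute)
  also have "\<dots> \<le> 3 ^ r * exp (\<Sum>i<r. sqrt (max (z i) 0)) * (2 * r)"
    by (intro mult_right_mono 2) auto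
  finally show ?thesis by (simp add: mult_ac)
qed

text \<open>Colour \<open>j\<close> contributes at most -2r to the sum of quotients and each of the
  other r - 1 colours at most 2; hence the threshold 6r. The product in front is at least 1 and
  cannot shrink the negative value.\<close>

lemma test_fun_le_minus_1:
  assumes j: "j < r" "z j < - (6 * real r)"
  shows "test_fun r z \<le> -1"
proof -
  have "z j / (2 + cosh_sqrt (z j)) \<le> z j / 3"
    using j by (intro div_cosh_sqrt_le_neg) (smt (verit) of_nat_0_le_iff)
  then have 1: "z j / (2 + cosh_sqrt (z j)) \<le> - 2 * r"
    using j(2) by linarith
  have "(\<Sum>i\<in>{..<r} - {j}. z i / (2 + cosh_sqrt (z i))) \<le> (\<Sum>i\<in>{..<r} - {j}. 2)"
    by (intro sum_mono div_cosh_sqrt_le)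
  also have "\<dots> = 2 * real (r - 1)"
    using j by simp
  finally have "(\<Sum>i<r. z i / (2 + cosh_sqrt (z i))) \<le> - 2 * r + 2 * real (r - 1)"
    using 1 j(1) by (subst sum.remove[of _ j]) auto
  also have "\<dots> \<le> - 1"
    using j by (simp add: of_nat_diff)
  finally have 2: "(\<Sum>i<r. z i / (2 + cosh_sqrt (z i))) \<le> - 1" .
  have "1 \<le> 2 + cosh_sqrt (z i)" for i
    using cosh_sqrt_ge[of "z i"] by linarith
  then have "1 \<le> (\<Prod>i<r. 2 + cosh_sqrt (z i))"
    by (intro prod_ge_1)
  then have "1 * 1 \<le> (\<Prod>i<r. 2 + cosh_sqrt (z i)) * - (\<Sum>i<r. z i / (2 + cosh_sqrt (z i)))"
    using 2 by (intro mult_mono) auto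
  then show ?thesis
    unfolding test_fun_eq by simp
qed

lemma psd_multiplier_test_fun:
  assumes "\<And>i. i < r \<Longrightarrow> psd_multiplier X (K i)"
  shows "psd_multiplier X (\<lambda>x y. test_fun r (\<lambda>i. K i x y))"
  unfolding test_fun_def
  using assms
  by (intro psd_multiplier_sum psd_multiplier_mult psd_multiplier_prod psd_multiplier_add
      psd_multiplier_const psd_multiplier_cosh_sqrt) auto

text \<open>The rate r + 1 beats by one unit the growth rate r of the bound on
  \<open>test_fun\<close> in the square root of a shifted correlation, which leaves a geometric
  series; the logarithm pays for the constants of \<open>test_fun_le\<close> and of that
  series.\<close>

definition geo_const :: "nat \<Rightarrow> real"
  where "geo_const r = real r + 1 + ln (1 + 4 * real r ^ 2 * 3 ^ r * exp (real r))"

lemma geo_const_ge_1: "1 \<le> geo_const r"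
  by (simp add: geo_const_def)

section \<open>From tail bounds to a popular level\<close>

lemma sum_exp_neg_le_2: "(\<Sum>j\<le>n. exp (- real j)) \<le> 2 - exp (- real n)"
proof (induction n)
  case (Suc n)
  have "2 \<le> exp (1::real)"
    using exp_ge_add_one_self[of 1] by simp
  then have "2 * exp (- real (Suc n)) \<le> exp 1 * exp (- real (Suc n))"
    by (intro mult_right_mono) auto
  also have "\<dots> = exp (- real n)"
    by (simp add: exp_add[symmetric])
  finally show ?case using Suc by simp
qed simp

text \<open>Slicing by the integer part j of \<open>s\<close>: there the summand is at most exp (a
  (j + 1)), and the tail rate \<open>a + 1\<close> leaves exp (- j), whose sum is below 2.\<close>

lemma sum_exp_le_of_tail:
  fixes s :: "'a \<Rightarrow> real"
  assumes Z: "finite Z" and s: "\<And>w. w \<in> Z \<Longrightarrow> 0 \<le> s w" and "0 \<le> c" "0 \<le> a"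
    and tail: "\<And>j::nat. real (card {w \<in> Z. real j \<le> s w}) \<le> c * exp (- (a + 1) * real j)"
  shows "(\<Sum>w\<in>Z. exp (a * s w)) \<le> 2 * c * exp a"
proof -
  obtain J :: nat where J: "\<And>w. w \<in> Z \<Longrightarrow> s w \<le> real J"
  proof -
    obtain J :: nat where "Max (s ` Z) \<le> real J" using real_arch_simple by blast
    then have "s w \<le> real J" if "w \<in> Z" for w
      using Z that by (meson Max_ge finite_imageI imageI order_trans)
    then show ?thesis by (rule that)
  qed
  have "exp (a * s w) \<le> (\<Sum>j\<le>J. if real j \<le> s w then exp (a * (real j + 1)) else 0)" if w: "w \<in> Z" for w
  proof -
    define j where "j = nat \<lfloor>s w\<rfloor>"
    have j: "real j \<le> s w" "s w \<le> real j + 1"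
      using s[OF w] unfolding j_def by linarith+
    then have "real j \<le> real J" using J[OF w] by linarith
    then have "(if real j \<le> s w then exp (a * (real j + 1)) else 0)
        \<le> (\<Sum>j\<le>J. if real j \<le> s w then exp (a * (real j + 1)) else 0)"
      by (intro member_le_sum) auto
    moreover have "exp (a * s w) \<le> exp (a * (real j + 1))"
      using j \<open>0 \<le> a\<close> by (simp add: mult_left_mono)
    ultimately show ?thesis
      using j by (simp only: if_True)
  qed
  then have "(\<Sum>w\<in>Z. exp (a * s w))
      \<le> (\<Sum>w\<in>Z. \<Sum>j\<le>J. if real j \<le> s w then exp (a * (real j + 1)) else 0)"
    by (rule sum_mono)
  also have "\<dots> = (\<Sum>j\<le>J. \<Sum>w\<in>Z. if real j \<le> s w then exp (a * (real j + 1)) else 0)"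
    by (rule sum.swap)
  also have "\<dots> = (\<Sum>j\<le>J. real (card {w \<in> Z. real j \<le> s w}) * exp (a * (real j + 1)))"
    using Z by (intro sum.cong) (auto simp: sum.If_cases Int_def)
  also have "\<dots> \<le> (\<Sum>j\<le>J. c * exp (- (a + 1) * real j) * exp (a * (real j + 1)))"
    by (intro sum_mono mult_right_mono tail) auto
  also have "\<dots> = (\<Sum>j\<le>J. c * exp a * exp (- real j))"
    by (intro sum.cong) (auto simp: mult.assoc exp_add[symmetric] algebra_simps)
  also have "\<dots> = c * exp a * (\<Sum>j\<le>J. exp (- real j))"
    by (simp add: sum_distrib_left)
  also have "\<dots> \<le> c * exp a * 2"
    using sum_exp_neg_le_2[of J] \<open>0 \<le> c\<close>
    by (intro mult_left_mono) (smt (verit) exp_ge_zero, simp)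
  finally show ?thesis by (simp add: mult_ac)
qed

text \<open>The exponent is at most \<open>r\<close> times its largest summand. This decouples the
  colours, so that tail bounds for one colour at a time suffice.\<close>

lemma exp_sum_le_sum_exp:
  fixes s :: "nat \<Rightarrow> real"
  assumes "r \<ge> 1"
  shows "exp (\<Sum>i<r. s i) \<le> (\<Sum>i<r. exp (real r * s i))"
proof -
  have "Max (s ` {..<r}) \<in> s ` {..<r}"
    using assms by (intro Max_in) (auto simp: lessThan_empty_iff)
  then obtain i where i: "i < r" "s i = Max (s ` {..<r})" by auto
  have "(\<Sum>j<r. s j) \<le> (\<Sum>j<r. s i)"
    using i by (intro sum_mono) auto
  then have "exp (\<Sum>j<r. s j) \<le> exp (real r * s i)" by simp
  also have "\<dots> \<le> (\<Sum>i<r. exp (real r * s i))"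
    using i by (intro member_le_sum[of i]) auto
  finally show ?thesis .
qed

text \<open>The paper's continuous threshold \<open>\<lambda>\<close> is restricted to the values \<open>k\<^sup>2 - 6r\<close>, which replaces an
  integral by a geometric series.\<close>
lemma exists_popular_level:
  fixes z :: "nat \<Rightarrow> 'b \<Rightarrow> real"
  assumes r: "r \<ge> 1" and Z: "finite Z" "Z \<noteq> {}"
    and nonneg: "0 \<le> (\<Sum>w\<in>Z. test_fun r (\<lambda>i. z i w))"
  shows "\<exists>i<r. \<exists>k::nat. exp (- geo_const r * (real k + 1)) * real (card Z)
    \<le> real (card {w \<in> Z. (\<forall>j<r. - (6 * real r) \<le> z j w) \<and> real k ^ 2 - 6 * real r \<le> z i w})"
proof (rule ccontr)
  define N where "N = real (card Z)"
  define B where "B = 1 + 4 * real r ^ 2 * 3 ^ r * exp (real r)"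
  define G where "G = {w \<in> Z. \<forall>j<r. - (6 * real r) \<le> z j w}"
  have N: "N > 0" using Z by (simp add: N_def card_gt_0_iff)
  have B: "B > 0" unfolding B_def by (intro add_pos_nonneg) auto
  have G: "finite G" "G \<subseteq> Z" using Z by (auto simp: G_def)
  \<comment> \<open>If no level is popular, the pairs outside \<open>G\<close> contribute at most -1
    each, in total less than N / B - N, and the pairs in \<open>G\<close> at most N - N / B, so the
    whole sum is negative.\<close>
  assume "\<not> ?thesis"
  then have less: "real (card {w \<in> G. real k ^ 2 - 6 * real r \<le> z i w})
      < exp (- geo_const r * (real k + 1)) * N" if "i < r" for i and k :: nat
    using that unfolding G_def N_def by (auto simp: not_le conj_ac)
  have geo: "exp (- geo_const r * (real k + 1)) \<le> 1 / B * exp (- (real r + 1) * real k)" for k :: nat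
  proof -
    have "1 \<le> B" unfolding B_def by simp
    then have "0 \<le> ln B * real k" by simp
    then have "- geo_const r * (real k + 1) \<le> - ln B + - (real r + 1) * real k"
      unfolding geo_const_def B_def[symmetric] by (simp add: algebra_simps)
    then have "exp (- geo_const r * (real k + 1)) \<le> exp (- ln B + - (real r + 1) * real k)" by simp
    also have "\<dots> = 1 / B * exp (- (real r + 1) * real k)"
      unfolding exp_add using B by (simp add: exp_minus inverse_eq_divide)
    finally show ?thesis .
  qed
  have cardG: "real (card G) < N / B"
  proof -
    \<comment> \<open>Level 0 imposes nothing beyond membership in \<open>G\<close>, so its
      unpopularity already bounds the size of \<open>G\<close>.\<close>
    have "{w \<in> G. real 0 ^ 2 - 6 * real r \<le> z 0 w} = G"
      using r by (auto simp: G_def)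
    then show ?thesis
      using less[of 0 0] geo[of 0] r N mult_right_mono[of "exp (- geo_const r)" "1 / B" N] by simp
  qed
  have tail: "(\<Sum>w\<in>G. exp (real r * sqrt (z i w + 6 * real r))) \<le> 2 * (N / B) * exp (real r)"
    if i: "i < r" for i
  proof (rule sum_exp_le_of_tail)
    fix j :: nat
    have "real j \<le> sqrt (z i w + 6 * real r) \<longleftrightarrow> real j ^ 2 - 6 * real r \<le> z i w" for w
      using real_sqrt_le_iff[of "real j ^ 2" "z i w + 6 * real r"] by auto
    then have "real (card {w \<in> G. real j \<le> sqrt (z i w + 6 * real r)})
        \<le> exp (- geo_const r * (real j + 1)) * N"
      using less[OF i, of j] by simp
    also have "\<dots> \<le> 1 / B * exp (- (real r + 1) * real j) * N"
      using N by (intro mult_right_mono geo) auto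
    finally show "real (card {w \<in> G. real j \<le> sqrt (z i w + 6 * real r)})
        \<le> N / B * exp (- (real r + 1) * real j)" by (simp add: mult_ac)
  qed (use G N B i in \<open>auto simp: G_def\<close>)
  have good: "test_fun r (\<lambda>i. z i w) \<le> 2 * real r * 3 ^ r * (\<Sum>i<r. exp (real r * sqrt (z i w + 6 * real r)))"
    if "w \<in> G" for w
  proof -
    have "sqrt (max (z i w) 0) \<le> sqrt (z i w + 6 * real r)" if "i < r" for i
      using that \<open>w \<in> G\<close> by (auto simp: G_def)
    then have "exp (\<Sum>i<r. sqrt (max (z i w) 0)) \<le> exp (\<Sum>i<r. sqrt (z i w + 6 * real r))"
      by (subst exp_le_cancel_iff, intro sum_mono) auto
    also have "\<dots> \<le> (\<Sum>i<r. exp (real r * sqrt (z i w + 6 * real r)))"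
      by (rule exp_sum_le_sum_exp[OF r])
    finally have "2 * real r * 3 ^ r * exp (\<Sum>i<r. sqrt (max (z i w) 0))
        \<le> 2 * real r * 3 ^ r * (\<Sum>i<r. exp (real r * sqrt (z i w + 6 * real r)))"
      by (intro mult_left_mono) auto
    then show ?thesis
      using test_fun_le[of r "\<lambda>i. z i w"] by linarith
  qed
  have "(\<Sum>w\<in>G. test_fun r (\<lambda>i. z i w))
      \<le> (\<Sum>w\<in>G. 2 * real r * 3 ^ r * (\<Sum>i<r. exp (real r * sqrt (z i w + 6 * real r))))"
    by (intro sum_mono good)
  also have "\<dots> = 2 * real r * 3 ^ r * (\<Sum>i<r. \<Sum>w\<in>G. exp (real r * sqrt (z i w + 6 * real r)))"
    by (subst sum.swap) (simp add: sum_distrib_left)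
  also have "\<dots> \<le> 2 * real r * 3 ^ r * (\<Sum>i<r. 2 * (N / B) * exp (real r))"
    by (intro mult_left_mono sum_mono tail) auto
  \<comment> \<open>\<open>B\<close> was chosen so that \<open>B - 1\<close> is exactly the constant
    produced by the preceding estimates.\<close>
  also have "\<dots> = N / B * (B - 1)"
    by (simp add: B_def power2_eq_square)
  finally have 1: "(\<Sum>w\<in>G. test_fun r (\<lambda>i. z i w)) \<le> N / B * (B - 1)" .
  have "(\<Sum>w\<in>Z - G. test_fun r (\<lambda>i. z i w)) \<le> (\<Sum>w\<in>Z - G. - 1)"
    by (intro sum_mono) (auto simp: G_def not_le intro: test_fun_le_minus_1)
  also have "\<dots> = real (card G) - N"
    using G Z by (simp add: card_Diff_subset of_nat_diff card_mono N_def)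
  finally have "(\<Sum>w\<in>Z - G. test_fun r (\<lambda>i. z i w)) \<le> real (card G) - N" .
  moreover have "(\<Sum>w\<in>Z. test_fun r (\<lambda>i. z i w))
      = (\<Sum>w\<in>Z - G. test_fun r (\<lambda>i. z i w)) + (\<Sum>w\<in>G. test_fun r (\<lambda>i. z i w))"
    using G Z by (intro sum.subset_diff)
  ultimately have "0 < N / B - N + N / B * (B - 1)"
    using nonneg 1 cardG by linarith
  then show False using B by (simp add: field_simps)
qed

text \<open>For sets of equal size the centred inner product is the size of the intersection minus
  its expected value \<open>q * d\<close>, with no error term; a Gram kernel built from it measures
  how neighbourhoods correlate.\<close>

lemma sum_centred_indicators:
  fixes q :: real
  assumes "finite Y" "A \<subseteq> Y" "B \<subseteq> Y" "card A = d" "card B = d" "Y \<noteq> {}" "q = real d / real (card Y)"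
  shows "(\<Sum>v\<in>Y. ((if v \<in> A then 1 else 0) - q) * ((if v \<in> B then 1 else 0) - q))
    = real (card (A \<inter> B)) - q * real d"
proof -
  have "((if v \<in> A then 1 else 0) - q) * ((if v \<in> B then 1 else 0) - q)
      = (if v \<in> A \<inter> B then 1 else 0) - q * (if v \<in> A then 1 else 0)
        - q * (if v \<in> B then 1 else 0) + q * q" for v
    by (auto simp: algebra_simps)
  moreover have "Y \<inter> {x. x \<in> A} = A" "Y \<inter> {x. x \<in> B} = B" "Y \<inter> {x. x \<in> A \<and> x \<in> B} = A \<inter> B"
    using assms by auto
  ultimately have "(\<Sum>v\<in>Y. ((if v \<in> A then 1 else 0) - q) * ((if v \<in> B then 1 else 0) - q))
      = real (card (A \<inter> B)) - q * real d - q * real d + real (card Y) * (q * q)"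
    using assms(1-6) by (simp add: sum.distrib sum_subtractf sum_distrib_left[symmetric] sum.If_cases)
  moreover have "real (card Y) * (q * q) = q * real d"
    using assms by simp
  ultimately show ?thesis by simp
qed

section \<open>The book algorithm\<close>

locale edge_colouring =
  fixes V :: "'a set" and r :: nat and col :: "'a \<Rightarrow> 'a \<Rightarrow> nat"
  assumes finite_V: "finite V"
    and col_commute: "col x y = col y x"
    and col_less: "x \<in> V \<Longrightarrow> y \<in> V \<Longrightarrow> x \<noteq> y \<Longrightarrow> col x y < r"
    and r_ge_2: "2 \<le> r"
begin

definition nbhd :: "nat \<Rightarrow> 'a \<Rightarrow> 'a set"
  where "nbhd i x = {y \<in> V. y \<noteq> x \<and> col x y = i}"

definition mono_clique :: "nat \<Rightarrow> 'a set \<Rightarrow> bool"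
  where "mono_clique i A \<longleftrightarrow> (\<forall>x\<in>A. \<forall>y\<in>A. x \<noteq> y \<longrightarrow> col x y = i)"

lemma finite_nbhd: "finite (nbhd i x)"
  using finite_V by (simp add: nbhd_def)

lemma finite_subset_V: "A \<subseteq> V \<Longrightarrow> finite A"
  using finite_V finite_subset by blast

lemma card_eq_sum_nbhd:
  assumes "X \<subseteq> V" "x \<in> V"
  shows "card (X - {x}) = (\<Sum>i<r. card (nbhd i x \<inter> X))"
proof -
  have "X - {x} = (\<Union>i<r. nbhd i x \<inter> X)"
    using assms col_less by (auto simp: nbhd_def)
  then have "card (X - {x}) = card (\<Union>i\<in>{..<r}. nbhd i x \<inter> X)" by simp
  also have "\<dots> = (\<Sum>i<r. card (nbhd i x \<inter> X))"
    by (intro card_UN_disjoint) (auto simp: finite_nbhd, auto simp: nbhd_def)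
  finally show ?thesis .
qed

text \<open>The normalised excess codegrees \<open>z i\<close> are Gram kernels, so
  \<open>test_fun\<close> of them has nonnegative sum over X \<times> X and some level is popular
  among pairs; averaging over the first coordinate then fixes \<open>x\<close>. The diagonal is
  included, so \<open>x\<close> may itself lie in \<open>X'\<close>.\<close>

lemma key_lemma:
  fixes d :: "nat \<Rightarrow> nat" and \<alpha> :: "nat \<Rightarrow> real"
  assumes X: "X \<subseteq> V" "X \<noteq> {}"
    and Y: "\<And>i. i < r \<Longrightarrow> Y i \<subseteq> V"
    and d: "\<And>i x. i < r \<Longrightarrow> x \<in> X \<Longrightarrow> d i \<le> card (nbhd i x \<inter> Y i)"
    and pos: "\<And>i. i < r \<Longrightarrow> 0 < d i" "\<And>i. i < r \<Longrightarrow> 0 < \<alpha> i"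
  obtains x X' Y' i k where "x \<in> X" "X' \<subseteq> X" "i < r"
    and "exp (- geo_const r * (real k + 1)) * real (card X) \<le> real (card X')"
    and "\<And>j. j < r \<Longrightarrow> Y' j \<subseteq> nbhd j x \<inter> Y j" "\<And>j. j < r \<Longrightarrow> card (Y' j) = d j"
    and "\<And>j y. j < r \<Longrightarrow> y \<in> X' \<Longrightarrow>
      (real (d j) / real (card (Y j)) - 6 * real r * \<alpha> j) * real (d j) \<le> real (card (nbhd j y \<inter> Y' j))"
    and "\<And>y. y \<in> X' \<Longrightarrow>
      (real (d i) / real (card (Y i)) + (real k ^ 2 - 6 * real r) * \<alpha> i) * real (d i) \<le> real (card (nbhd i y \<inter> Y' i))"
proof -
  \<comment> \<open>Cutting all neighbourhoods down to the same size makes the inner products below exact.\<close>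
  have "\<exists>S. S \<subseteq> nbhd i x \<inter> Y i \<and> card S = d i" if "i < r" "x \<in> X" for i x
    using d[OF that] by (meson obtain_subset_with_card_n)
  then obtain S where S: "\<And>i x. i < r \<Longrightarrow> x \<in> X \<Longrightarrow> S i x \<subseteq> nbhd i x \<inter> Y i"
    and card_S: "\<And>i x. i < r \<Longrightarrow> x \<in> X \<Longrightarrow> card (S i x) = d i"
    by metis
  define q where "q i = real (d i) / real (card (Y i))" for i
  \<comment> \<open>The product of two such factors is normalised by
    \<open>\<alpha> i * d i\<close>; a value c of \<open>z i\<close> at (x, y) then means that
    \<open>nbhd i y\<close> has density at least q + c \<alpha> in \<open>S i x\<close>.\<close>
  define s where "s i x v = ((if v \<in> S i x then 1 else 0) - q i) / sqrt (\<alpha> i * real (d i))" for i x v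
  define z where "z i w = (\<Sum>v\<in>Y i. s i (fst w) v * s i (snd w) v)" for i w
  have z: "z i (x, y) = (real (card (S i x \<inter> S i y)) - q i * real (d i)) / (\<alpha> i * real (d i))"
    if "i < r" "x \<in> X" "y \<in> X" for i x y
  proof -
    have "Y i \<noteq> {}" using pos(1)[of i] d[of i x] that by auto
    moreover have "finite (Y i)" using Y[of i] that finite_subset_V by auto
    ultimately have "(\<Sum>v\<in>Y i. ((if v \<in> S i x then 1 else 0) - q i) * ((if v \<in> S i y then 1 else 0) - q i))
        = real (card (S i x \<inter> S i y)) - q i * real (d i)"
      using that S[of i x] S[of i y] card_S[of i x] card_S[of i y]
      by (intro sum_centred_indicators) (auto simp: q_def)
    moreover have "sqrt (\<alpha> i * real (d i)) * sqrt (\<alpha> i * real (d i)) = \<alpha> i * real (d i)"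
      using pos[of i] that by simp
    ultimately show ?thesis
      unfolding z_def s_def by (simp add: times_divide_times_eq sum_divide_distrib[symmetric])
  qed
  have z_ge: "(q i + c * \<alpha> i) * real (d i) \<le> real (card (nbhd i y \<inter> S i x))"
    if "i < r" "x \<in> X" "y \<in> X" "c \<le> z i (x, y)" for i x y c
  proof -
    have "0 < \<alpha> i * real (d i)" using pos[of i] that by simp
    then have "c * (\<alpha> i * real (d i)) \<le> real (card (S i x \<inter> S i y)) - q i * real (d i)"
      using that by (simp add: z pos_le_divide_eq)
    moreover have "card (S i x \<inter> S i y) \<le> card (nbhd i y \<inter> S i x)"
      using S[of i y] that finite_nbhd by (intro card_mono) auto
    ultimately show ?thesis by (simp add: algebra_simps)
  qed
  have fX: "finite X" using X finite_subset_V by auto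
  have "0 \<le> (\<Sum>x\<in>X. \<Sum>y\<in>X. test_fun r (\<lambda>i. z i (x, y)))"
    by (intro psd_multiplier_sum_nonneg psd_multiplier_test_fun)
      (simp add: z_def psd_multiplier_gram)
  also have "\<dots> = (\<Sum>w\<in>X \<times> X. test_fun r (\<lambda>i. z i w))"
    by (simp add: sum.cartesian_product)
  finally obtain i k where ik: "i < r" and
    "exp (- geo_const r * (real k + 1)) * real (card (X \<times> X))
      \<le> real (card {w \<in> X \<times> X. (\<forall>j<r. - (6 * real r) \<le> z j w) \<and> real k ^ 2 - 6 * real r \<le> z i w})"
    using exists_popular_level[of r "X \<times> X" z] r_ge_2 fX X by auto
  moreover define X' where
    "X' x = {y \<in> X. (\<forall>j<r. - (6 * real r) \<le> z j (x, y)) \<and> real k ^ 2 - 6 * real r \<le> z i (x, y)}" for x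
  moreover have "{w \<in> X \<times> X. (\<forall>j<r. - (6 * real r) \<le> z j w) \<and> real k ^ 2 - 6 * real r \<le> z i w}
      = (SIGMA x:X. X' x)"
    by (auto simp: X'_def)
  moreover have "finite (X' x)" for x using fX by (simp add: X'_def)
  ultimately have sum: "exp (- geo_const r * (real k + 1)) * (real (card X) * real (card X))
      \<le> (\<Sum>x\<in>X. real (card (X' x)))"
    using fX by (simp add: card_cartesian_product)
  have "\<exists>x\<in>X. exp (- geo_const r * (real k + 1)) * real (card X) \<le> real (card (X' x))"
  proof (rule ccontr)
    assume "\<not> ?thesis"
    then have "(\<Sum>x\<in>X. real (card (X' x))) < (\<Sum>x\<in>X. exp (- geo_const r * (real k + 1)) * real (card X))"
      using fX X by (intro sum_strict_mono) auto
    then show False using sum by (simp add: mult_ac)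
  qed
  then obtain x where x: "x \<in> X" "exp (- geo_const r * (real k + 1)) * real (card X) \<le> real (card (X' x))"
    by blast
  show ?thesis
  proof (rule that[of x "X' x" i k "\<lambda>j. S j x"])
    show "(real (d j) / real (card (Y j)) - 6 * real r * \<alpha> j) * real (d j) \<le> real (card (nbhd j y \<inter> S j x))"
      if "j < r" "y \<in> X' x" for j y
      using z_ge[of j x y "- (6 * real r)"] that x by (simp add: X'_def q_def)
    show "(real (d i) / real (card (Y i)) + (real k ^ 2 - 6 * real r) * \<alpha> i) * real (d i)
      \<le> real (card (nbhd i y \<inter> S i x))" if "y \<in> X' x" for y
      using z_ge[of i x y "real k ^ 2 - 6 * real r"] that x ik by (simp add: X'_def q_def)
  qed (use x ik S card_S in \<open>auto simp: X'_def\<close>)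
qed

end

section \<open>Logarithmic estimates and the state of the book algorithm\<close>

lemma ln_one_plus_ge:
  fixes u :: real
  assumes "0 \<le> u"
  shows "u / (1 + u) \<le> ln (1 + u)"
proof -
  have "ln (1 / (1 + u)) \<le> 1 / (1 + u) - 1"
    using assms by (intro ln_le_minus_one) simp
  then show ?thesis using assms by (simp add: ln_div field_simps)
qed

lemma exp_minus_two_le:
  fixes t :: real
  assumes "2 \<le> t"
  shows "exp (- (2 / t)) \<le> 1 - 1 / t"
proof -
  have "1 + 1 / (t - 1) \<le> exp (1 / (t - 1))" by (rule exp_ge_add_one_self)
  also have "\<dots> \<le> exp (2 / t)"
    using assms by (simp add: field_simps)
  finally have "exp (- (2 / t)) \<le> inverse (1 + 1 / (t - 1))"
    using assms unfolding exp_minus by (intro le_imp_inverse_le) (auto intro: add_pos_nonneg)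
  also have "\<dots> = 1 - 1 / t" using assms by (simp add: field_simps)
  finally show ?thesis .
qed

text \<open>The bound 12 r \<le> \<kappa>^2 gives k^2 - 6 r \<ge> k^2 / 2 at every level k \<ge>
  \<kappa>, and \<kappa>^2 \<le> 12 r t keeps u \<le> 1 in \<open>gain \<kappa>\<close> = ln (1 +
  u), so that this is at least u / 2. The algorithm maintains the density floor p - \<delta>, over
  which \<delta> is the initial excess.\<close>

locale book_setup = edge_colouring +
  fixes X0 :: "'a set" and Y0 :: "nat \<Rightarrow> 'a set" and p \<delta> :: real and t \<kappa> :: nat
  assumes X0: "X0 \<subseteq> V" and Y0: "i < r \<Longrightarrow> Y0 i \<subseteq> V"
    and Y0_nonempty: "i < r \<Longrightarrow> Y0 i \<noteq> {}"
    and delta: "0 < \<delta>" "\<delta> < p" "\<delta> \<le> 1"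
    and t_ge_2: "2 \<le> t"
    and kappa: "12 * r \<le> \<kappa>\<^sup>2" "\<kappa>\<^sup>2 \<le> 12 * r * t"
    and min_degree: "i < r \<Longrightarrow> x \<in> X0 \<Longrightarrow> p * card (Y0 i) \<le> card (nbhd i x \<inter> Y0 i)"
begin

text \<open>The excess is at least \<open>\<delta> * exp (g - 2)\<close> and, being part of a
  density, at most 1; solving for \<open>g\<close> gives this cap.\<close>

definition max_gain :: real
  where "max_gain = 2 - ln \<delta>"

text \<open>Logarithm of the growth of the excess guaranteed at a level k \<ge> \<kappa>: (k^2 - 6
  r) \<alpha> \<ge> k^2 \<alpha> / 2 with \<alpha> = q / (6 r t).\<close>

definition gain :: "nat \<Rightarrow> real"
  where "gain k = ln (1 + real k ^ 2 / (12 * real r * real t))"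

text \<open>A colour step happens at a level k < \<kappa>, so k + 1 \<le> \<kappa>. In the factor 2
  r, the 2 pays for removing \<open>x\<close> and the r for choosing a popular colour.\<close>

definition colour_cost :: real
  where "colour_cost = geo_const r * real \<kappa> + ln (2 * real r)"

text \<open>Price in the reservoir per unit of logarithmic gain. A boost at level k costs at most 2
  k \<open>geo_const\<close> and gains k^2 / (12 r t) to first order, so the worst ratio occurs at k
  = \<kappa>; the factor exp 2 / \<delta> covers the saturation of the logarithm at large k.\<close>

definition boost_cost :: real
  where "boost_cost = 24 * real r * real t * geo_const r * exp 2 / (\<delta> * real \<kappa>)"

definition excess :: "real \<Rightarrow> nat \<Rightarrow> real"
  where "excess g \<tau> = \<delta> * exp (g - 2 * real \<tau> / real t)"

text \<open>The functions \<open>b\<close> and \<open>g\<close> record the number of density boosts in each colour and the total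
  logarithmic gain they produced; each of the at most \<open>t\<close> colour steps loses a factor \<open>exp (- 2 / t)\<close>
  of the density excess over \<open>p - \<delta>\<close>.\<close>
definition book_state ::
    "'a set \<Rightarrow> (nat \<Rightarrow> 'a set) \<Rightarrow> (nat \<Rightarrow> 'a set) \<Rightarrow> (nat \<Rightarrow> real) \<Rightarrow> (nat \<Rightarrow> nat) \<Rightarrow> bool"
  where "book_state X Y T g b \<longleftrightarrow> X \<subseteq> X0
    \<and> exp (- colour_cost * real (\<Sum>i<r. card (T i)) - boost_cost * (\<Sum>i<r. g i)) * real (card X0) \<le> real (card X)
    \<and> (\<forall>i<r. Y i \<subseteq> Y0 i \<and> T i \<subseteq> X0 \<and> mono_clique i (T i) \<and> (\<forall>x\<in>T i. X \<union> Y i \<subseteq> nbhd i x)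
      \<and> card (T i) \<le> t \<and> 0 \<le> g i \<and> gain \<kappa> * real (b i) \<le> g i
      \<and> (\<forall>x\<in>X. (p - \<delta> + excess (g i) (card (T i))) * real (card (Y i)) \<le> real (card (nbhd i x \<inter> Y i)))
      \<and> (p - \<delta>) ^ (card (T i) + b i) * real (card (Y0 i)) \<le> real (card (Y i)))"

lemma excess_pos: "0 < excess g \<tau>"
  using delta by (simp add: excess_def)

lemma excess_ge: "\<tau> \<le> t \<Longrightarrow> \<delta> * exp (g - 2) \<le> excess g \<tau>"
  using delta t_ge_2 by (simp add: excess_def field_simps)

lemma kappa_pos: "0 < \<kappa>"
  using kappa r_ge_2 by (auto intro!: Nat.gr0I)

lemma gain_mono: "k \<le> k' \<Longrightarrow> gain k \<le> gain k'"
  unfolding gain_def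
  by (intro ln_mono add_left_mono divide_right_mono power_mono add_pos_nonneg) auto

lemma gain_kappa_ge: "real \<kappa> ^ 2 / (24 * real r * real t) \<le> gain \<kappa>"
proof -
  define u where "u = real \<kappa> ^ 2 / (12 * real r * real t)"
  have "real (\<kappa>\<^sup>2) \<le> real (12 * r * t)" using kappa by (simp only: of_nat_le_iff)
  then have u: "0 \<le> u" "u \<le> 1"
    using r_ge_2 t_ge_2 by (auto simp: u_def)
  then have "u / 2 \<le> u / (1 + u)" by (intro divide_left_mono) auto
  also have "\<dots> \<le> gain \<kappa>" using ln_one_plus_ge[OF u(1)] by (simp add: gain_def u_def)
  finally show ?thesis by (simp add: u_def)
qed

lemma gain_kappa_pos: "0 < gain \<kappa>"
  using gain_kappa_ge r_ge_2 t_ge_2 kappa_pos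
  by (smt (verit) divide_pos_pos mult_pos_pos of_nat_0_less_iff zero_less_power zero_less_numeral
      less_le_trans pos2)

lemma costs_nonneg: "0 \<le> colour_cost" "0 \<le> boost_cost"
  using geo_const_ge_1[of r] delta r_ge_2 by (auto simp: colour_cost_def boost_cost_def)

lemma excess_le_1:
  assumes "book_state X Y T g b" "i < r" "X \<noteq> {}" "Y i \<noteq> {}"
  shows "excess (g i) (card (T i)) \<le> 1"
proof -
  obtain x where "x \<in> X" using assms by blast
  have "finite (Y i)" using assms(1,2) Y0 finite_subset_V unfolding book_state_def by (meson order_trans)
  then have "0 < real (card (Y i))" using assms by (simp add: card_gt_0_iff)
  have "(p - \<delta> + excess (g i) (card (T i))) * real (card (Y i)) \<le> real (card (nbhd i x \<inter> Y i))"
    using assms \<open>x \<in> X\<close> unfolding book_state_def by blast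
  also have "\<dots> \<le> 1 * real (card (Y i))"
    using \<open>finite (Y i)\<close> by (simp add: card_mono)
  finally have "p - \<delta> + excess (g i) (card (T i)) \<le> 1"
    using \<open>0 < real (card (Y i))\<close> mult_right_le_imp_le by blast
  then show ?thesis using delta by linarith
qed

lemma book_state_nonempty:
  assumes "book_state X Y T g b" "X0 \<noteq> {}"
  shows "X \<noteq> {}" "i < r \<Longrightarrow> Y i \<noteq> {}"
proof -
  have "0 < real (card X0)"
    using assms(2) X0 finite_subset_V by (simp add: card_gt_0_iff)
  then have "0 < exp (- colour_cost * real (\<Sum>i<r. card (T i)) - boost_cost * (\<Sum>i<r. g i)) * real (card X0)"
    by simp
  also have "\<dots> \<le> real (card X)" using assms(1) unfolding book_state_def by blast
  finally show "X \<noteq> {}" by auto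
next
  assume i: "i < r"
  have "0 < (p - \<delta>) ^ (card (T i) + b i) * real (card (Y0 i))"
    using Y0[OF i] Y0_nonempty[OF i] finite_subset_V delta by (auto simp: card_gt_0_iff)
  also have "\<dots> \<le> real (card (Y i))" using assms(1) i unfolding book_state_def by blast
  finally show "Y i \<noteq> {}" by auto
qed

lemma book_state_gain_le:
  assumes "book_state X Y T g b" "X0 \<noteq> {}" "i < r"
  shows "g i \<le> max_gain"
proof -
  have "excess (g i) (card (T i)) \<le> 1"
    by (intro excess_le_1[OF assms(1,3)] book_state_nonempty[OF assms(1,2)] assms(3))
  moreover have "card (T i) \<le> t" using assms unfolding book_state_def by blast
  ultimately have "\<delta> * exp (g i - 2) \<le> 1" using excess_ge by (meson order_trans)
  then have "ln (\<delta> * exp (g i - 2)) \<le> ln 1"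
    using delta by (subst ln_le_cancel_iff) auto
  then show ?thesis using delta by (simp add: ln_mult max_gain_def)
qed

lemma book_state_init: "book_state X0 Y0 (\<lambda>_. {}) (\<lambda>_. 0) (\<lambda>_. 0)"
  using X0 Y0 min_degree by (auto simp: book_state_def mono_clique_def excess_def)

text \<open>If the level k is below \<kappa>, \<open>x\<close> joins the spine of a colour j popular
  between \<open>x\<close> and \<open>X1\<close>. The lower bound of \<open>key_lemma\<close> holds
  in all colours, so j may differ from the colour i singled out there. Otherwise only
  \<open>Y i\<close> is replaced: no spine grows, and the density gained in colour i pays for the
  shrinking of the reservoir.\<close>

lemma book_state_step:
  assumes st: "book_state X Y T g b"
    and less: "\<And>i. i < r \<Longrightarrow> card (T i) < t"
    and large: "exp (2 * colour_cost * real r * real t + boost_cost * real r * max_gain) \<le> real (card X0)"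
  obtains X' Y' T' g' b' where "book_state X' Y' T' g' b'"
    "(\<Sum>i<r. card (T' i) + b' i) = Suc (\<Sum>i<r. card (T i) + b i)"
proof -
  have "0 < real (card X0)" using large by (smt (verit) exp_gt_zero)
  then have X0_nonempty: "X0 \<noteq> {}" by auto
  note nonempty = book_state_nonempty[OF st X0_nonempty]
  have XX0: "X \<subseteq> X0" and X_card: "exp (- colour_cost * real (\<Sum>i<r. card (T i)) - boost_cost * (\<Sum>i<r. g i))
      * real (card X0) \<le> real (card X)"
    using st unfolding book_state_def by blast+
  have Y_sub: "Y i \<subseteq> Y0 i" and T_sub: "T i \<subseteq> X0" and T_mono: "mono_clique i (T i)"
    and T_nbhd: "\<And>x. x \<in> T i \<Longrightarrow> X \<union> Y i \<subseteq> nbhd i x"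
    and g_nonneg: "0 \<le> g i" and b_le: "gain \<kappa> * real (b i) \<le> g i"
    and deg: "\<And>x. x \<in> X \<Longrightarrow> (p - \<delta> + excess (g i) (card (T i))) * real (card (Y i)) \<le> real (card (nbhd i x \<inter> Y i))"
    and Y_card: "(p - \<delta>) ^ (card (T i) + b i) * real (card (Y0 i)) \<le> real (card (Y i))" if "i < r" for i
    using st that unfolding book_state_def by blast+
  have XV: "X \<subseteq> V" using XX0 X0 by blast
  have YV: "Y i \<subseteq> V" if "i < r" for i using that Y_sub Y0 by blast
  have card_Y_pos: "0 < real (card (Y i))" if "i < r" for i
    using that nonempty(2) YV finite_subset_V by (simp add: card_gt_0_iff)
  \<comment> \<open>The degree guaranteed by the invariant, rounded up. The excess
    \<open>q i\<close> is computed after rounding, so rounding never loses density.\<close>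
  define d where "d i = nat \<lceil>(p - \<delta> + excess (g i) (card (T i))) * real (card (Y i))\<rceil>" for i
  define q where "q i = real (d i) / real (card (Y i)) - (p - \<delta>)" for i
  have d_ge: "(p - \<delta> + excess (g i) (card (T i))) * real (card (Y i)) \<le> real (d i)" for i
    unfolding d_def by linarith
  have q_ge: "excess (g i) (card (T i)) \<le> q i" if "i < r" for i
    using d_ge[of i] card_Y_pos[OF that] by (simp add: q_def field_simps)
  then have q_pos: "0 < q i" if "i < r" for i
    using that excess_pos by (meson less_le_trans)
  have d_pos: "0 < d i" if "i < r" for i
  proof -
    have "0 < (p - \<delta> + excess (g i) (card (T i))) * real (card (Y i))"
      using card_Y_pos[OF that] excess_pos delta by (intro mult_pos_pos add_pos_pos) auto
    then show ?thesis using d_ge[of i] by linarith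
  qed
  have d_ge': "(p - \<delta>) * real (card (Y i)) \<le> real (d i)" if "i < r" for i
    using q_pos[OF that] card_Y_pos[OF that] by (simp add: q_def field_simps)
  have d_le: "d i \<le> card (nbhd i x \<inter> Y i)" if "i < r" "x \<in> X" for i x
    using deg[OF that] unfolding d_def by (metis ceiling_le of_int_of_nat_eq nat_le_iff)
  \<comment> \<open>This makes \<open>6 * r * \<alpha> i\<close> equal to \<open>q i / t\<close>: a
    colour step keeps at least the fraction 1 - 1/t of the excess, so t steps lose only a constant
    factor.\<close>
  define \<alpha> where "\<alpha> i = q i / (6 * real r * real t)" for i
  have alpha_pos: "0 < \<alpha> i" if "i < r" for i
    using q_pos[OF that] r_ge_2 t_ge_2 by (simp add: \<alpha>_def)
  obtain x X1 Y1 i k where x: "x \<in> X" and X1: "X1 \<subseteq> X" and i: "i < r"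
    and X1_card: "exp (- geo_const r * (real k + 1)) * real (card X) \<le> real (card X1)"
    and Y1: "\<And>j. j < r \<Longrightarrow> Y1 j \<subseteq> nbhd j x \<inter> Y j" and Y1_card: "\<And>j. j < r \<Longrightarrow> card (Y1 j) = d j"
    and deg1: "\<And>j y. j < r \<Longrightarrow> y \<in> X1 \<Longrightarrow>
      (real (d j) / real (card (Y j)) - 6 * real r * \<alpha> j) * real (d j) \<le> real (card (nbhd j y \<inter> Y1 j))"
    and deg2: "\<And>y. y \<in> X1 \<Longrightarrow>
      (real (d i) / real (card (Y i)) + (real k ^ 2 - 6 * real r) * \<alpha> i) * real (d i) \<le> real (card (nbhd i y \<inter> Y1 i))"
    by (rule key_lemma[OF XV nonempty(1) YV d_le d_pos alpha_pos]) blast+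
  have "0 < exp (- geo_const r * (real k + 1)) * real (card X)"
    using nonempty(1) XV finite_subset_V by (simp add: card_gt_0_iff)
  then have X1_nonempty: "X1 \<noteq> {}" using X1_card by auto
  have X1V: "X1 \<subseteq> V" using X1 XV by blast
  have Y1_size: "(p - \<delta>) ^ Suc (card (T j) + b j) * real (card (Y0 j)) \<le> real (card (Y1 j))" if "j < r" for j
  proof -
    have "(p - \<delta>) ^ Suc (card (T j) + b j) * real (card (Y0 j)) \<le> (p - \<delta>) * real (card (Y j))"
      using Y_card[OF that] delta by (simp add: mult.assoc mult_left_mono)
    also have "\<dots> \<le> real (card (Y1 j))" using d_ge'[OF that] Y1_card[OF that] by simp
    finally show ?thesis .
  qed
  show ?thesis
  proof (cases "k < \<kappa>")
    case True
    have gains: "(\<Sum>i<r. g i) \<le> real r * max_gain"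
      using sum_bounded_above[of "{..<r}" g max_gain] book_state_gain_le[OF st X0_nonempty] by simp
    have "(\<Sum>i<r. card (T i)) \<le> r * t"
      using sum_bounded_above[of "{..<r}" "\<lambda>i. card (T i)" t] less by (simp add: less_imp_le)
    then have "real (\<Sum>i<r. card (T i)) \<le> real r * real t" by (metis of_nat_le_iff of_nat_mult)
    then have "colour_cost * real (\<Sum>i<r. card (T i)) + boost_cost * (\<Sum>i<r. g i)
        \<le> colour_cost * (real r * real t) + boost_cost * (real r * max_gain)"
      using gains costs_nonneg by (intro add_mono mult_left_mono)
    \<comment> \<open>The assumption \<open>large\<close> contains
      \<open>colour_cost * r * t\<close> twice: once for all past colour steps and once for the
      present one.\<close>
    moreover have "colour_cost * 1 \<le> colour_cost * (real r * real t)"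
    proof -
      have "1 * 1 \<le> real r * real t" using r_ge_2 t_ge_2 by (intro mult_mono) auto
      then show ?thesis using costs_nonneg by (intro mult_left_mono) auto
    qed
    ultimately have "colour_cost \<le> - colour_cost * real (\<Sum>i<r. card (T i)) - boost_cost * (\<Sum>i<r. g i)
        + (2 * colour_cost * real r * real t + boost_cost * real r * max_gain)"
      by (simp add: algebra_simps)
    then have "exp colour_cost \<le> exp (- colour_cost * real (\<Sum>i<r. card (T i)) - boost_cost * (\<Sum>i<r. g i))
        * exp (2 * colour_cost * real r * real t + boost_cost * real r * max_gain)"
      by (simp add: exp_add[symmetric])
    also have "\<dots> \<le> exp (- colour_cost * real (\<Sum>i<r. card (T i)) - boost_cost * (\<Sum>i<r. g i)) * real (card X0)"
      by (intro mult_left_mono large) auto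
    also have "\<dots> \<le> real (card X)" by (rule X_card)
    finally have X_ge: "exp colour_cost \<le> real (card X)" .
    have exp_cost: "exp (- colour_cost) * (2 * real r) = exp (- geo_const r * real \<kappa>)"
      using r_ge_2 by (simp add: colour_cost_def exp_diff)
    have "exp (- geo_const r * real \<kappa>) \<le> exp (- geo_const r * (real k + 1))"
      using True geo_const_ge_1[of r] by (simp add: mult_left_mono)
    then have "exp (- geo_const r * real \<kappa>) * real (card X) \<le> exp (- geo_const r * (real k + 1)) * real (card X)"
      by (rule mult_right_mono) simp
    then have X1_ge: "exp (- colour_cost) * (2 * real r) * real (card X) \<le> real (card X1)"
      using X1_card exp_cost by simp
    have "2 * real r = exp (- colour_cost) * (2 * real r) * exp colour_cost"
      by (simp add: exp_minus field_simps)
    also have "\<dots> \<le> exp (- colour_cost) * (2 * real r) * real (card X)"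
      by (intro mult_left_mono X_ge) auto
    finally have "2 \<le> real (card X1)" using X1_ge r_ge_2 by linarith
    \<comment> \<open>\<open>x\<close> may lie in \<open>X1\<close>; as \<open>X1\<close> has at
      least two elements, removing it costs at most a factor 2.\<close>
    moreover have "card X1 - 1 \<le> card (X1 - {x})" by (simp add: card_Diff_singleton_if)
    ultimately have "real (card X1) / 2 \<le> real (card (X1 - {x}))" by linarith
    then have half: "exp (- colour_cost) * real (card X) * real r \<le> real (card (X1 - {x}))"
      using X1_ge by (simp add: mult_ac)
    have xV: "x \<in> V" using x XV by blast
    obtain j where j: "j < r" and "exp (- colour_cost) * real (card X) \<le> real (card (nbhd j x \<inter> X1))"
    proof (rule ccontr)
      assume "\<not> thesis"
      then have "(\<Sum>j<r. real (card (nbhd j x \<inter> X1))) < (\<Sum>j<r. exp (- colour_cost) * real (card X))"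
        using that r_ge_2 by (intro sum_strict_mono) (auto simp: lessThan_empty_iff not_le[symmetric])
      moreover have "(\<Sum>j<r. real (card (nbhd j x \<inter> X1))) = real (card (X1 - {x}))"
        by (simp add: card_eq_sum_nbhd[OF X1V xV])
      ultimately show False using half by (simp add: mult_ac)
    qed
    moreover define X2 where "X2 = nbhd j x \<inter> X1"
    ultimately have X2_card: "exp (- colour_cost) * real (card X) \<le> real (card X2)" by simp
    have X2: "X2 \<subseteq> X" "X2 \<subseteq> nbhd j x" using X1 by (auto simp: X2_def)
    have x_notin: "x \<notin> T j" using T_nbhd[OF j, of x] x by (auto simp: nbhd_def)
    define T' where "T' = T(j := insert x (T j))"
    define Y' where "Y' = Y(j := Y1 j)"
    have fT: "finite (T j)" using T_sub[OF j] X0 finite_subset_V by blast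
    have card_T': "card (T' i) = card (T i) + (if i = j then 1 else 0)" for i
      using x_notin fT by (simp add: T'_def)
    have sum_T': "(\<Sum>i<r. card (T' i)) = Suc (\<Sum>i<r. card (T i))"
      using j by (simp add: card_T' sum.distrib)
    have mono_j: "mono_clique j (insert x (T j))"
    proof -
      have "col y x = j" if "y \<in> T j" for y
        using T_nbhd[OF j that] x by (auto simp: nbhd_def)
      then show ?thesis
        using T_mono[OF j] col_commute by (auto simp: mono_clique_def)
    qed
    have deg_j: "(p - \<delta> + excess (g j) (Suc (card (T j)))) * real (card (Y1 j)) \<le> real (card (nbhd j y \<inter> Y1 j))"
      if "y \<in> X2" for y
    proof -
      have "excess (g j) (Suc (card (T j))) = excess (g j) (card (T j)) * exp (- (2 / real t))"
        by (simp add: excess_def mult.assoc exp_add[symmetric] add_divide_distrib algebra_simps)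
      also have "\<dots> \<le> q j * (1 - 1 / real t)"
        using q_ge[OF j] q_pos[OF j] exp_minus_two_le[of "real t"] t_ge_2
        by (intro mult_mono) auto
      also have "\<dots> = real (d j) / real (card (Y j)) - 6 * real r * \<alpha> j - (p - \<delta>)"
      proof -
        have "6 * real r * \<alpha> j = q j / real t"
          using r_ge_2 by (simp add: \<alpha>_def)
        moreover have "q j * (1 - 1 / real t) = q j - q j / real t"
          by (simp add: right_diff_distrib)
        ultimately show ?thesis using q_def[of j] by linarith
      qed
      finally have "(p - \<delta> + excess (g j) (Suc (card (T j)))) * real (d j)
          \<le> (real (d j) / real (card (Y j)) - 6 * real r * \<alpha> j) * real (d j)"
        by (intro mult_right_mono) auto
      also have "\<dots> \<le> real (card (nbhd j y \<inter> Y1 j))"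
        using that by (intro deg1[OF j]) (simp add: X2_def)
      finally show ?thesis by (simp add: Y1_card[OF j])
    qed
    have "book_state X2 Y' T' g b"
      unfolding book_state_def
    proof (intro conjI allI impI)
      show "X2 \<subseteq> X0" using X2 XX0 by blast
      have "exp (- colour_cost * real (\<Sum>i<r. card (T' i)) - boost_cost * (\<Sum>i<r. g i)) * real (card X0)
          = exp (- colour_cost) * (exp (- colour_cost * real (\<Sum>i<r. card (T i)) - boost_cost * (\<Sum>i<r. g i)) * real (card X0))"
        unfolding sum_T' by (simp add: mult.assoc[symmetric] exp_add[symmetric] algebra_simps)
      also have "\<dots> \<le> exp (- colour_cost) * real (card X)"
        by (intro mult_left_mono X_card) auto
      finally show "exp (- colour_cost * real (\<Sum>i<r. card (T' i)) - boost_cost * (\<Sum>i<r. g i)) * real (card X0)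
          \<le> real (card X2)" using X2_card by linarith
    next
      fix i assume i: "i < r"
      show "Y' i \<subseteq> Y0 i" using Y_sub[OF i] Y1[OF i] by (auto simp: Y'_def)
      show "T' i \<subseteq> X0" using T_sub[OF i] x XX0 by (auto simp: T'_def)
      show "mono_clique i (T' i)" using T_mono[OF i] mono_j by (auto simp: T'_def)
      show "card (T' i) \<le> t" using less[OF i] by (auto simp: card_T')
      show "0 \<le> g i" "gain \<kappa> * real (b i) \<le> g i" using i g_nonneg b_le by auto
      have Y'_sub: "Y' i \<subseteq> Y i" using Y1[OF i] by (auto simp: Y'_def)
      show "\<forall>y\<in>T' i. X2 \<union> Y' i \<subseteq> nbhd i y"
      proof
        fix y assume y: "y \<in> T' i"
        show "X2 \<union> Y' i \<subseteq> nbhd i y"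
        proof (cases "y \<in> T i")
          case True
          then show ?thesis using T_nbhd[OF i True] X2(1) Y'_sub by blast
        next
          case False
          then have "i = j" "y = x" using y by (auto simp: T'_def split: if_splits)
          then show ?thesis using X2(2) Y1[OF j] by (simp add: Y'_def)
        qed
      qed
      show "\<forall>y\<in>X2. (p - \<delta> + excess (g i) (card (T' i))) * real (card (Y' i)) \<le> real (card (nbhd i y \<inter> Y' i))"
        using deg_j deg[OF i] X2 by (auto simp: card_T' Y'_def)
      show "(p - \<delta>) ^ (card (T' i) + b i) * real (card (Y0 i)) \<le> real (card (Y' i))"
        using Y_card[OF i] Y1_size[OF i] by (auto simp: card_T' Y'_def)
    qed
    moreover have "(\<Sum>i<r. card (T' i) + b i) = Suc (\<Sum>i<r. card (T i) + b i)"
      using sum_T' by (simp add: sum.distrib)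
    ultimately show ?thesis by (rule that)
  next
    case False
    define u where "u = real k ^ 2 / (12 * real r * real t)"
    have u: "0 \<le> u" by (simp add: u_def)
    have gain_k: "gain k = ln (1 + u)" by (simp add: gain_def u_def)
    have k: "1 \<le> real k" using False kappa_pos by simp
    have "12 * real r \<le> real k ^ 2"
    proof -
      have "12 * real r \<le> real (\<kappa>\<^sup>2)" using kappa(1) by (metis of_nat_le_iff of_nat_mult of_nat_numeral)
      also have "\<dots> \<le> real k ^ 2" using False by (simp add: power_mono)
      finally show ?thesis .
    qed
    then have "u * q i \<le> (real k ^ 2 - 6 * real r) * \<alpha> i"
      using q_pos[OF i] r_ge_2 t_ge_2 by (simp add: u_def \<alpha>_def field_simps)
    then have "p - \<delta> + (1 + u) * q i \<le> real (d i) / real (card (Y i)) + (real k ^ 2 - 6 * real r) * \<alpha> i"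
      using q_def[of i] distrib_right[of 1 u "q i"] by linarith
    then have deg_i: "(p - \<delta> + (1 + u) * q i) * real (card (Y1 i)) \<le> real (card (nbhd i y \<inter> Y1 i))"
      if "y \<in> X1" for y
      using deg2[OF that] mult_right_mono[of _ _ "real (d i)"] Y1_card[OF i] by (smt (verit) of_nat_0_le_iff)
    have fY1: "finite (Y1 i)" using Y1[OF i] finite_nbhd finite_subset by blast
    \<comment> \<open>A density is at most 1, which bounds 1 + u by exp 2 / \<delta> and keeps ln (1
      + u) comparable to u even at very high levels.\<close>
    have "p - \<delta> + (1 + u) * q i \<le> 1"
    proof -
      obtain y where "y \<in> X1" using X1_nonempty by blast
      then have "(p - \<delta> + (1 + u) * q i) * real (card (Y1 i)) \<le> real (card (nbhd i y \<inter> Y1 i))"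
        by (rule deg_i)
      also have "\<dots> \<le> 1 * real (card (Y1 i))" using fY1 by (simp add: card_mono)
      finally show ?thesis using d_pos[OF i] Y1_card[OF i] by (metis mult_right_le_imp_le of_nat_0_less_iff)
    qed
    moreover have "(1 + u) * (\<delta> * exp (- 2)) \<le> (1 + u) * q i"
    proof -
      have "\<delta> * exp (- 2) \<le> \<delta> * exp (g i - 2)" using delta g_nonneg[OF i] by simp
      also have "\<dots> \<le> q i" using excess_ge[of "card (T i)" "g i"] q_ge[OF i] less[OF i] by linarith
      finally show ?thesis using u by (intro mult_left_mono) auto
    qed
    ultimately have "(1 + u) * (\<delta> * exp (- 2)) \<le> 1" using delta by linarith
    then have "u * (\<delta> * exp (- 2)) \<le> u * (1 / (1 + u))"
      using u by (intro mult_left_mono) (auto simp: field_simps)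
    also have "\<dots> \<le> gain k" using ln_one_plus_ge[OF u] by (simp add: gain_k)
    finally have "boost_cost * (u * (\<delta> * exp (- 2))) \<le> boost_cost * gain k"
      by (intro mult_left_mono costs_nonneg)
    moreover have "boost_cost * (u * (\<delta> * exp (- 2))) = 2 * geo_const r * real k ^ 2 / real \<kappa>"
      using delta r_ge_2 t_ge_2 kappa_pos by (simp add: boost_cost_def u_def exp_minus field_simps)
    moreover have "2 * geo_const r * real k \<le> 2 * geo_const r * real k ^ 2 / real \<kappa>"
      using False kappa_pos geo_const_ge_1[of r] by (simp add: power2_eq_square field_simps)
    moreover have "geo_const r * (real k + 1) \<le> 2 * geo_const r * real k"
      using k geo_const_ge_1[of r] by (simp add: algebra_simps)
    ultimately have cost: "geo_const r * (real k + 1) \<le> boost_cost * gain k" by linarith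
    define g' where "g' = g(i := g i + gain k)"
    define b' where "b' = b(i := Suc (b i))"
    define Y' where "Y' = Y(i := Y1 i)"
    have gain_k_ge: "gain \<kappa> \<le> gain k" using False by (intro gain_mono) simp
    have sum_g': "(\<Sum>i<r. g' i) = (\<Sum>i<r. g i) + gain k"
    proof -
      have "g' j = g j + (if j = i then gain k else 0)" for j by (simp add: g'_def)
      then show ?thesis using i by (simp add: sum.distrib)
    qed
    have sum_b': "(\<Sum>j<r. card (T j) + b' j) = Suc (\<Sum>j<r. card (T j) + b j)"
    proof -
      have "b' j = b j + (if j = i then 1 else 0)" for j by (simp add: b'_def)
      then show ?thesis using i by (simp add: sum.distrib)
    qed
    have excess_i: "excess (g i + gain k) (card (T i)) \<le> (1 + u) * q i"
    proof -
      have "exp (gain k) = 1 + u" using u by (simp add: gain_k)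
      then have "excess (g i + gain k) (card (T i)) = (1 + u) * excess (g i) (card (T i))"
        by (simp add: excess_def exp_add exp_diff)
      also have "\<dots> \<le> (1 + u) * q i" using q_ge[OF i] u by (intro mult_left_mono) auto
      finally show ?thesis .
    qed
    have "book_state X1 Y' T g' b'"
      unfolding book_state_def
    proof (intro conjI allI impI)
      show "X1 \<subseteq> X0" using X1 XX0 by blast
      have "exp (- colour_cost * real (\<Sum>i<r. card (T i)) - boost_cost * (\<Sum>i<r. g' i)) * real (card X0)
          = exp (- boost_cost * gain k) * (exp (- colour_cost * real (\<Sum>i<r. card (T i)) - boost_cost * (\<Sum>i<r. g i)) * real (card X0))"
        unfolding sum_g' by (simp add: mult.assoc[symmetric] exp_add[symmetric] algebra_simps)
      also have "\<dots> \<le> exp (- boost_cost * gain k) * real (card X)"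
        by (intro mult_left_mono X_card) auto
      also have "\<dots> \<le> exp (- geo_const r * (real k + 1)) * real (card X)"
        using cost by (intro mult_right_mono) auto
      finally show "exp (- colour_cost * real (\<Sum>i<r. card (T i)) - boost_cost * (\<Sum>i<r. g' i)) * real (card X0)
          \<le> real (card X1)" using X1_card by linarith
    next
      fix j assume j: "j < r"
      show "Y' j \<subseteq> Y0 j" using Y_sub[OF j] Y1[OF j] by (auto simp: Y'_def)
      show "T j \<subseteq> X0" "mono_clique j (T j)" using j T_sub T_mono by auto
      show "card (T j) \<le> t" using less[OF j] by simp
      show "0 \<le> g' j" using g_nonneg[OF j] gain_k_ge gain_kappa_pos by (auto simp: g'_def)
      show "gain \<kappa> * real (b' j) \<le> g' j" using b_le[OF j] gain_k_ge by (auto simp: g'_def b'_def algebra_simps)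
      have "Y' j \<subseteq> Y j" using Y1[OF j] by (auto simp: Y'_def)
      then show "\<forall>y\<in>T j. X1 \<union> Y' j \<subseteq> nbhd j y"
        using T_nbhd[OF j] X1 by blast
      show "\<forall>y\<in>X1. (p - \<delta> + excess (g' j) (card (T j))) * real (card (Y' j)) \<le> real (card (nbhd j y \<inter> Y' j))"
      proof
        fix y assume y: "y \<in> X1"
        show "(p - \<delta> + excess (g' j) (card (T j))) * real (card (Y' j)) \<le> real (card (nbhd j y \<inter> Y' j))"
        proof (cases "j = i")
          case True
          have "(p - \<delta> + excess (g i + gain k) (card (T i))) * real (card (Y1 i))
              \<le> (p - \<delta> + (1 + u) * q i) * real (card (Y1 i))"
            using excess_i by (intro mult_right_mono) auto
          then show ?thesis using deg_i[OF y] True by (simp add: g'_def Y'_def)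
        next
          case False
          then show ?thesis using deg[OF j] y X1 by (auto simp: g'_def Y'_def)
        qed
      qed
      show "(p - \<delta>) ^ (card (T j) + b' j) * real (card (Y0 j)) \<le> real (card (Y' j))"
        using Y_card[OF j] Y1_size[OF j] by (auto simp: b'_def Y'_def)
    qed
    then show ?thesis using sum_b' by (rule that)
  qed
qed

text \<open>While no spine has \<open>t\<close> vertices, each step raises the total number of spine
  vertices and boosts by one. Both are bounded, the boosts by
  \<open>max_gain / gain \<kappa>\<close> per colour, so some spine fills up.\<close>

theorem book_exists:
  assumes large: "exp (2 * colour_cost * real r * real t + boost_cost * real r * max_gain) \<le> real (card X0)"
  obtains i T Y b where "i < r" "T \<subseteq> X0" "card T = t" "mono_clique i T" "Y \<subseteq> Y0 i"
    "\<forall>x\<in>T. Y \<subseteq> nbhd i x"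
    "real b \<le> 24 * real r * real t * max_gain / real \<kappa> ^ 2"
    "(p - \<delta>) ^ (t + b) * real (card (Y0 i)) \<le> real (card Y)"
proof -
  have "0 < real (card X0)" using large by (smt (verit) exp_gt_zero)
  then have X0_nonempty: "X0 \<noteq> {}" by auto
  have b_le: "real (b i) \<le> max_gain / gain \<kappa>" if "book_state X Y T g b" "i < r" for X Y T g b i
  proof -
    have "gain \<kappa> * real (b i) \<le> g i" using that unfolding book_state_def by blast
    also have "\<dots> \<le> max_gain" using that X0_nonempty by (intro book_state_gain_le)
    finally show ?thesis using gain_kappa_pos by (simp add: field_simps)
  qed
  have "\<exists>X Y T g b. book_state X Y T g b \<and> (\<exists>i<r. card (T i) = t)"
  proof (rule ccontr)
    assume not_done: "\<not> ?thesis"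
    have "\<exists>X Y T g b. book_state X Y T g b \<and> (\<Sum>i<r. card (T i) + b i) = n" for n
    proof (induction n)
      case 0
      show ?case using book_state_init by fastforce
    next
      case (Suc n)
      then obtain X Y T g b where st: "book_state X Y T g b" "(\<Sum>i<r. card (T i) + b i) = n" by blast
      have "card (T i) < t" if "i < r" for i
      proof -
        have "card (T i) \<le> t" using st(1) that unfolding book_state_def by blast
        moreover have "card (T i) \<noteq> t" using st(1) that not_done by blast
        ultimately show ?thesis by simp
      qed
      then obtain X' Y' T' g' b' where "book_state X' Y' T' g' b'"
        "(\<Sum>i<r. card (T' i) + b' i) = Suc (\<Sum>i<r. card (T i) + b i)"
        by (rule book_state_step[OF st(1) _ large])
      then show ?case using st(2) by blast
    qed
    moreover obtain n :: nat where n: "real r * (real t + max_gain / gain \<kappa>) < real n"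
      using reals_Archimedean2 by blast
    ultimately obtain X Y T g b where st: "book_state X Y T g b" "(\<Sum>i<r. card (T i) + b i) = n" by blast
    have "real n = (\<Sum>i<r. real (card (T i)) + real (b i))" using st(2) by auto
    also have "\<dots> \<le> (\<Sum>i<r. real t + max_gain / gain \<kappa>)"
      using st(1) b_le[OF st(1)] by (intro sum_mono add_mono) (auto simp: book_state_def)
    finally show False using n by simp
  qed
  then obtain X Y T g b i where st: "book_state X Y T g b" and i: "i < r" and t: "card (T i) = t" by blast
  have "max_gain / gain \<kappa> \<le> max_gain / (real \<kappa> ^ 2 / (24 * real r * real t))"
    using gain_kappa_ge kappa_pos r_ge_2 t_ge_2 delta gain_kappa_pos
    by (intro divide_left_mono) (auto simp: max_gain_def intro: order_trans[of _ 0])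
  then have "real (b i) \<le> 24 * real r * real t * max_gain / real \<kappa> ^ 2"
    using b_le[OF st i] by (simp add: mult_ac)
  then show ?thesis
    using st i t unfolding book_state_def by (intro that[of i "T i" "Y i" "b i"]) auto
qed

end

section \<open>The Erdos--Szekeres bound with weights\<close>

context edge_colouring
begin

definition has_clique :: "(nat \<Rightarrow> nat) \<Rightarrow> 'a set \<Rightarrow> bool"
  where "has_clique a W \<longleftrightarrow> (\<exists>i<r. \<exists>A\<subseteq>W. card A = a i \<and> mono_clique i A)"

lemma has_clique_zero: "i < r \<Longrightarrow> a i = 0 \<Longrightarrow> has_clique a W"
  unfolding has_clique_def mono_clique_def by (rule exI[of _ i]) (auto intro!: exI[of _ "{}"])

lemma has_clique_extend:
  assumes clique: "has_clique (a(i := a i - card T)) Y" and i: "i < r"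
    and T: "mono_clique i T" and sub: "T \<subseteq> W" "Y \<subseteq> W" "W \<subseteq> V"
    and nbhd: "\<And>x. x \<in> T \<Longrightarrow> Y \<subseteq> nbhd i x"
  shows "has_clique a W"
proof -
  obtain j A where j: "j < r" "A \<subseteq> Y" "card A = (a(i := a i - card T)) j" "mono_clique j A"
    using clique unfolding has_clique_def by blast
  show ?thesis
  proof (cases "j = i")
    case False
    then have "card A = a j" "A \<subseteq> W" using j sub by auto
    then show ?thesis using j unfolding has_clique_def by blast
  next
    case True
    have fin: "finite A" "finite T" using j sub finite_subset_V by blast+
    have disj: "A \<inter> T = {}" using nbhd j by (fastforce simp: nbhd_def)
    have "col x y = i" "col y x = i" if "x \<in> T" "y \<in> A" for x y
      using nbhd[OF that(1)] that j col_commute by (auto simp: nbhd_def)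
    then have mono: "mono_clique i (A \<union> T)"
      using T j True unfolding mono_clique_def by blast
    have "card (A \<union> T) = a i - card T + card T"
      using card_Un_disjoint[OF fin disj] j True by simp
    \<comment> \<open>Subtraction is truncated: \<open>T\<close> may have more than
      \<open>a i\<close> elements, so the union can be too large and is cut back to
      \<open>B\<close>.\<close>
    then have "a i \<le> card (A \<union> T)" by simp
    then obtain B where B: "B \<subseteq> A \<union> T" "card B = a i" by (meson obtain_subset_with_card_n)
    then have "B \<subseteq> W" using j(2) sub by blast
    moreover have "mono_clique i B" using mono B(1) unfolding mono_clique_def by blast
    ultimately show ?thesis using i B(2) unfolding has_clique_def by blast
  qed
qed

text \<open>The weights prescribe the share of a vertex's neighbours due to each colour. Some colour
  i reaches its share, and lowering \<open>a i\<close> by one multiplies the product by exactly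
  \<open>\<pi> i\<close>, so induction applies inside that neighbourhood.\<close>

lemma erdos_szekeres:
  fixes \<pi> :: "nat \<Rightarrow> real"
  assumes \<pi>: "\<And>i. i < r \<Longrightarrow> 0 < \<pi> i" "(\<Sum>i<r. \<pi> i) = 1"
    and W: "W \<subseteq> V" and large: "(\<Prod>i<r. (1 / \<pi> i) ^ a i) \<le> real (card W)"
  shows "has_clique a W"
proof -
  \<comment> \<open>The summand \<open>1 / (r - 1)\<close> absorbs the vertex \<open>x\<close> lost when passing to neighbourhoods.\<close>
  have "has_clique a W" if "W \<subseteq> V" "(\<Prod>i<r. (1 / \<pi> i) ^ a i) - 1 / (real r - 1) < real (card W)" for W
    using that
  proof (induction "\<Sum>i<r. a i" arbitrary: a W)
    case 0
    then show ?case using r_ge_2 by (intro has_clique_zero[of 0]) auto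
  next
    case (Suc n)
    define P where "P = (\<Prod>i<r. (1 / \<pi> i) ^ a i)"
    show ?case
    proof (cases "\<exists>i<r. a i = 0")
      case True
      then show ?thesis using has_clique_zero by blast
    next
      case False
      have "\<pi> i \<le> 1" if "i < r" for i
      proof -
        have "\<pi> i \<le> (\<Sum>i<r. \<pi> i)" using that \<pi>(1) by (intro member_le_sum) (auto intro: less_imp_le)
        then show ?thesis using \<pi>(2) by simp
      qed
      then have "1 \<le> P" unfolding P_def using \<pi>(1) by (intro prod_ge_1 one_le_power) simp_all
      moreover have "1 / (real r - 1) \<le> 1" using r_ge_2 by simp
      ultimately have "0 < real (card W)" using Suc.prems(2) unfolding P_def[symmetric] by linarith
      then obtain x where x: "x \<in> W" by fastforce
      have upd: "(\<Prod>j<r. (1 / \<pi> j) ^ (a(i := a i - 1)) j) = \<pi> i * P" if i: "i < r" for i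
      proof -
        have "P = (1 / \<pi> i) ^ a i * (\<Prod>j\<in>{..<r} - {i}. (1 / \<pi> j) ^ a j)"
          unfolding P_def using i by (simp add: prod.remove)
        moreover have "(\<Prod>j<r. (1 / \<pi> j) ^ (a(i := a i - 1)) j)
            = (1 / \<pi> i) ^ (a i - 1) * (\<Prod>j\<in>{..<r} - {i}. (1 / \<pi> j) ^ a j)"
          using i by (simp add: prod.remove)
        moreover have "(1 / \<pi> i) ^ (a i - 1) = \<pi> i * (1 / \<pi> i) ^ a i"
          using False i \<pi>(1)[OF i] by (cases "a i") auto
        ultimately show ?thesis by simp
      qed
      have "\<exists>i<r. \<pi> i * P - 1 / (real r - 1) < real (card (nbhd i x \<inter> W))"
      proof (rule ccontr)
        assume "\<not> ?thesis"
        then have "(\<Sum>i<r. real (card (nbhd i x \<inter> W))) \<le> (\<Sum>i<r. \<pi> i * P - 1 / (real r - 1))"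
          by (intro sum_mono) (meson lessThan_iff not_less)
        also have "\<dots> = P - real r / (real r - 1)"
          by (simp add: sum_subtractf sum_distrib_right[symmetric] \<pi>(2))
        also have "\<dots> = P - 1 - 1 / (real r - 1)"
          using r_ge_2 by (simp add: field_simps)
        also have "\<dots> < real (card W) - 1" using Suc.prems(2) by (simp add: P_def)
        finally have "real (\<Sum>i<r. card (nbhd i x \<inter> W)) < real (card W) - 1" by simp
        moreover have "(\<Sum>i<r. card (nbhd i x \<inter> W)) = card W - 1"
          using card_eq_sum_nbhd[of W x] Suc.prems(1) x by (auto simp: finite_subset_V)
        ultimately show False using \<open>0 < real (card W)\<close> by (simp add: of_nat_diff)
      qed
      then obtain i where i: "i < r" "\<pi> i * P - 1 / (real r - 1) < real (card (nbhd i x \<inter> W))" by blast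
      have "has_clique (a(i := a i - 1)) (nbhd i x \<inter> W)"
      proof (rule Suc.hyps(1))
        have "(\<Sum>j<r. a j) = a i + (\<Sum>j\<in>{..<r} - {i}. a j)"
          "(\<Sum>j<r. (a(i := a i - 1)) j) = a i - 1 + (\<Sum>j\<in>{..<r} - {i}. a j)"
          using i by (simp_all add: sum.remove)
        then show "n = (\<Sum>j<r. (a(i := a i - 1)) j)" using Suc.hyps(2) False i by auto
      qed (use Suc.prems i upd[of i] in auto)
      then show ?thesis
        using i Suc.prems(1) x
        by (intro has_clique_extend[of a i "{x}" "nbhd i x \<inter> W"]) (auto simp: mono_clique_def)
    qed
  qed
  moreover have "0 < 1 / (real r - 1)" using r_ge_2 by simp
  then have "(\<Prod>i<r. (1 / \<pi> i) ^ a i) - 1 / (real r - 1) < real (card W)"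
    using large by linarith
  ultimately show ?thesis using W by blast
qed

section \<open>Passing to a subset without low colour degrees\<close>

lemma exists_large_nbhd:
  assumes \<epsilon>: "0 < \<epsilon>" and W: "W \<subseteq> V" "x \<in> W" "real r / \<epsilon> \<le> real (card W)"
    and i: "i < r" "real (card (nbhd i x \<inter> W)) < (1 / real r - \<epsilon>) * real (card W)"
  shows "\<exists>j<r. (1 + \<epsilon>) / real r * real (card W) \<le> real (card (nbhd j x \<inter> W))"
proof (rule ccontr)
  define w where "w = real (card W)"
  assume "\<not> ?thesis"
  then have less: "real (card (nbhd j x \<inter> W)) < (1 + \<epsilon>) / real r * w" if "j < r" for j
    using that by (auto simp: w_def not_le)
  have r: "2 \<le> real r" using r_ge_2 by simp
  have "(\<Sum>j<r. real (card (nbhd j x \<inter> W)))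
      = real (card (nbhd i x \<inter> W)) + (\<Sum>j\<in>{..<r} - {i}. real (card (nbhd j x \<inter> W)))"
    using i by (simp add: sum.remove)
  also have "\<dots> \<le> real (card (nbhd i x \<inter> W)) + (\<Sum>j\<in>{..<r} - {i}. (1 + \<epsilon>) / real r * w)"
    using less by (intro add_left_mono sum_mono) (auto intro: less_imp_le)
  also have "\<dots> < (1 / real r - \<epsilon>) * w + (real r - 1) * ((1 + \<epsilon>) / real r * w)"
    using i r by (simp add: w_def of_nat_diff)
  \<comment> \<open>The other r - 1 colours, each with surplus below \<epsilon> w / r, cannot make
    up the deficit \<epsilon> w of colour i. At least \<epsilon> w / r is missing, and by the size
    assumption this is no less than the one vertex \<open>x\<close>.\<close>
  also have "\<dots> = w - \<epsilon> * w / real r"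
    using r by (simp add: field_simps)
  also have "\<dots> \<le> w - 1"
    using W(3) \<epsilon> r by (simp add: w_def field_simps)
  finally have "real (card (W - {x})) < w - 1"
    using card_eq_sum_nbhd[of W x] W by (simp add: subset_iff)
  moreover have "card W - 1 \<le> card (W - {x})" by (simp add: card_Diff_singleton_if)
  ultimately show False unfolding w_def by linarith
qed

text \<open>Moving into a neighbourhood in colour j lowers the demand \<open>a j\<close> by one, for
  which the uniform bound allows a factor 1 / r; a fraction (1 + \<epsilon>) / r is kept, so every
  step gains 1 + \<epsilon>. The process ends when no degree is low or when \<open>s0\<close> such
  gains have accumulated.\<close>

lemma regularise:
  assumes \<epsilon>: "0 < \<epsilon>" "\<epsilon> \<le> 1" and s0: "s0 \<le> k"
    and large: "real r / \<epsilon> \<le> ((1 + \<epsilon>) / real r) ^ s0 * real (card V)"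
  obtains s W a where "s \<le> s0" "W \<subseteq> V" "has_clique a W \<longrightarrow> has_clique (\<lambda>_. k) V"
    "\<forall>i<r. a i \<le> k \<and> k \<le> a i + s" "(\<Sum>i<r. a i) + s = r * k"
    "((1 + \<epsilon>) / real r) ^ s * real (card V) \<le> real (card W)"
    "s = s0 \<or> (\<forall>i<r. \<forall>x\<in>W. (1 / real r - \<epsilon>) * real (card W) \<le> real (card (nbhd i x \<inter> W)))"
proof -
  define P where "P W a s \<longleftrightarrow> W \<subseteq> V \<and> (has_clique a W \<longrightarrow> has_clique (\<lambda>_. k) V)
    \<and> (\<forall>i<r. a i \<le> k \<and> k \<le> a i + s) \<and> (\<Sum>i<r. a i) + s = r * k
    \<and> ((1 + \<epsilon>) / real r) ^ s * real (card V) \<le> real (card W)" for W a s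
  define R where "R W \<longleftrightarrow> (\<forall>i<r. \<forall>x\<in>W. (1 / real r - \<epsilon>) * real (card W) \<le> real (card (nbhd i x \<inter> W)))" for W
  have ratio: "0 \<le> (1 + \<epsilon>) / real r" "(1 + \<epsilon>) / real r \<le> 1" using \<epsilon> r_ge_2 by auto
  have "(\<exists>W a. P W a n) \<or> (\<exists>W a s. s \<le> s0 \<and> P W a s \<and> R W)" if "n \<le> s0" for n
    using that
  proof (induction n)
    case 0
    have "P V (\<lambda>_. k) 0" by (simp add: P_def)
    then show ?case by blast
  next
    case (Suc n)
    then consider W a where "P W a n" "\<not> R W" | "\<exists>W a s. s \<le> s0 \<and> P W a s \<and> R W"
      by (meson Suc_leD)
    then show ?case
    proof cases
      case 1
      have card_W: "((1 + \<epsilon>) / real r) ^ n * real (card V) \<le> real (card W)" and WV: "W \<subseteq> V"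
        using 1(1) by (auto simp: P_def)
      \<comment> \<open>The size assumption concerns stage \<open>s0\<close>; earlier stages inherit
        it because (1 + \<epsilon>) / r \<le> 1.\<close>
      have "((1 + \<epsilon>) / real r) ^ s0 \<le> ((1 + \<epsilon>) / real r) ^ n"
        using ratio Suc.prems by (intro power_decreasing) auto
      then have "((1 + \<epsilon>) / real r) ^ s0 * real (card V) \<le> ((1 + \<epsilon>) / real r) ^ n * real (card V)"
        by (rule mult_right_mono) simp
      then have W_large: "real r / \<epsilon> \<le> real (card W)" using card_W large by linarith
      obtain i x where ix: "i < r" "x \<in> W" "real (card (nbhd i x \<inter> W)) < (1 / real r - \<epsilon>) * real (card W)"
        using 1(2) by (auto simp: R_def not_le)
      then obtain j where j: "j < r" "(1 + \<epsilon>) / real r * real (card W) \<le> real (card (nbhd j x \<inter> W))"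
        using exists_large_nbhd[OF \<epsilon>(1) WV ix(2) W_large] by blast
      \<comment> \<open>Fewer than s0 \<le> k steps have been made, so no demand has reached
        0.\<close>
      have a_j: "0 < a j" using 1(1) j Suc.prems s0 by (fastforce simp: P_def)
      have "P (nbhd j x \<inter> W) (a(j := a j - 1)) (Suc n)"
        unfolding P_def
      proof (intro conjI impI allI)
        show "nbhd j x \<inter> W \<subseteq> V" using WV by blast
        assume "has_clique (a(j := a j - 1)) (nbhd j x \<inter> W)"
        then have "has_clique a W"
          using j WV ix
          by (intro has_clique_extend[of a j "{x}" "nbhd j x \<inter> W"]) (auto simp: mono_clique_def)
        then show "has_clique (\<lambda>_. k) V" using 1(1) by (simp add: P_def)
      next
        fix i assume i: "i < r"
        have "a i \<le> k" "k \<le> a i + n" using 1(1) i by (auto simp: P_def)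
        then show "(a(j := a j - 1)) i \<le> k" "k \<le> (a(j := a j - 1)) i + Suc n" using a_j by auto
      next
        have "(\<Sum>i<r. a i) = a j + (\<Sum>i\<in>{..<r} - {j}. a i)"
          "(\<Sum>i<r. (a(j := a j - 1)) i) = a j - 1 + (\<Sum>i\<in>{..<r} - {j}. a i)"
          using j by (simp_all add: sum.remove)
        moreover have "(\<Sum>i<r. a i) + n = r * k" using 1(1) by (simp add: P_def)
        ultimately show "(\<Sum>i<r. (a(j := a j - 1)) i) + Suc n = r * k"
          using a_j by linarith
      next
        have "((1 + \<epsilon>) / real r) ^ Suc n * real (card V) \<le> (1 + \<epsilon>) / real r * real (card W)"
          using mult_left_mono[OF card_W ratio(1)] by (simp add: mult.assoc)
        then show "((1 + \<epsilon>) / real r) ^ Suc n * real (card V) \<le> real (card (nbhd j x \<inter> W))"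
          using j(2) by linarith
      qed
      then show ?thesis by blast
    qed blast
  qed
  then obtain W a s where "s \<le> s0" "P W a s" "s = s0 \<or> R W" by blast
  then show ?thesis by (intro that[of s W a]) (auto simp: P_def R_def)
qed

end

section \<open>The saving from unequal colour weights\<close>

lemma exp_minus_double_le:
  fixes x :: real
  assumes "0 \<le> x" "x \<le> 1 / 2"
  shows "exp (- 2 * x) \<le> 1 - x"
proof -
  have "x * x \<le> x * (1 / 2)" using assms by (intro mult_left_mono)
  then have "- 2 * x \<le> ln (1 - x)"
    using ln_one_minus_pos_lower_bound[of x] assms by (simp add: power2_eq_square)
  then show ?thesis using assms by (simp add: ln_ge_iff)
qed

text \<open>The first-order terms z K and y (R - 1) K cancel because z = (R - 1) y, which leaves the
  linear gain z T. The choice y = T / (4 R K) keeps the second-order errors below half of this gain,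
  and S \<le> T / 4 limits the defect y S to a quarter of y T.\<close>

lemma skewed_exponent_le:
  fixes R K T S B y z :: real
  assumes R: "2 \<le> R" and K: "0 < K" and T: "0 \<le> T" and S: "0 \<le> S" "4 * S \<le> T"
    and B: "(R - 1) * K - S \<le> B"
    and y: "y = T / (4 * R * K)" "y \<le> 1" and z: "z = (R - 1) * y"
  shows "(z + 2 * z\<^sup>2) * (K - T) - (y - y\<^sup>2) * B \<le> - (T\<^sup>2 / (16 * R * K))"
proof -
  have y0: "0 \<le> y" using R K T y by simp
  have z0: "0 \<le> z" using R y0 z by simp
  have "y * y \<le> y * 1" using y0 y(2) by (intro mult_left_mono)
  then have "(y - y\<^sup>2) * ((R - 1) * K - S) \<le> (y - y\<^sup>2) * B"
    using B by (intro mult_left_mono) (auto simp: power2_eq_square)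
  moreover have "0 \<le> y\<^sup>2 * S" "0 \<le> z\<^sup>2 * T" using S T by auto
  ultimately have "(z + 2 * z\<^sup>2) * (K - T) - (y - y\<^sup>2) * B
      \<le> (2 * (R - 1)\<^sup>2 + (R - 1)) * (y * (y * K)) - (R - 1) * (y * T) + y * S"
    unfolding z by (simp add: power2_eq_square algebra_simps)
  also have "y * K = T / (4 * R)" using K by (simp add: y)
  also have "(2 * (R - 1)\<^sup>2 + (R - 1)) * (y * (T / (4 * R))) \<le> (R - 1) / 2 * (y * T)"
  proof -
    have "2 * (R - 1)\<^sup>2 + (R - 1) \<le> (R - 1) / 2 * (4 * R)"
      using R by (simp add: power2_eq_square field_simps)
    then have "(2 * (R - 1)\<^sup>2 + (R - 1)) / (4 * R) \<le> (R - 1) / 2"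
      using R by (subst pos_divide_le_eq) auto
    then have "(2 * (R - 1)\<^sup>2 + (R - 1)) / (4 * R) * (y * T) \<le> (R - 1) / 2 * (y * T)"
      using y0 T by (intro mult_right_mono) auto
    then show ?thesis by simp
  qed
  also have "(R - 1) / 2 * (y * T) - (R - 1) * (y * T) + y * S \<le> - (y * T / 4)"
  proof -
    have "1 * (y * T) \<le> (R - 1) * (y * T)" using R y0 T by (intro mult_right_mono) auto
    moreover have "y * (4 * S) \<le> y * T" using y0 S by (intro mult_left_mono)
    moreover have "(R - 1) / 2 * (y * T) = (R - 1) * (y * T) / 2" "y * (4 * S) = 4 * (y * S)" by simp_all
    ultimately show ?thesis by linarith
  qed
  also have "- (y * T / 4) = - (T\<^sup>2 / (16 * R * K))" by (simp add: y power2_eq_square)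
  finally show ?thesis by simp
qed

text \<open>Near-optimal weights when colour \<open>i\<close> needs \<open>t\<close> vertices fewer than the others, for
  \<open>y = t / (4rk)\<close>.\<close>
definition skewed_weight :: "nat \<Rightarrow> nat \<Rightarrow> real \<Rightarrow> nat \<Rightarrow> real"
  where "skewed_weight r i y j = (if j = i then 1 - (real r - 1) * y else 1 + y) / real r"

lemma sum_skewed_weight:
  assumes "i < r"
  shows "(\<Sum>j<r. skewed_weight r i y j) = 1"
proof -
  have "(\<Sum>j<r. skewed_weight r i y j)
      = (1 - (real r - 1) * y) / real r + (\<Sum>j\<in>{..<r} - {i}. (1 + y) / real r)"
    using assms by (simp add: sum.remove skewed_weight_def)
  also have "\<dots> = 1"
    using assms by (simp add: of_nat_diff field_simps)
  finally show ?thesis .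
qed

lemma skewed_weight_small:
  fixes k t r :: nat
  assumes "2 \<le> r" "0 < k" "t \<le> k" "y = real t / (4 * real r * real k)"
  shows "0 \<le> (real r - 1) * y" "(real r - 1) * y \<le> 1 / 2" "0 \<le> y" "y \<le> 1"
proof -
  show y0: "0 \<le> y" by (simp add: assms)
  then show z0: "0 \<le> (real r - 1) * y" using assms(1) by simp
  have "(real r - 1) * y \<le> real r * y" using y0 by (simp add: algebra_simps)
  also have "\<dots> = real t / (4 * real k)" using assms(1) by (simp add: assms(4))
  also have "\<dots> \<le> 1 / 2" using assms by (simp add: field_simps)
  finally show z: "(real r - 1) * y \<le> 1 / 2" .
  have "1 * y \<le> (real r - 1) * y" using assms(1) y0 by (intro mult_right_mono) auto
  then show "y \<le> 1" using z by simp
qed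

text \<open>Pulling the factor r out of every weight leaves r to the remaining total demand, times a
  product close to 1 whose logarithm is expanded to second order. Here \<open>s\<close> counts the
  regularisation steps, which may have lowered the demands of the other colours.\<close>

lemma prod_skewed_weight_le:
  fixes r k t s :: nat and a :: "nat \<Rightarrow> nat"
  assumes r: "2 \<le> r" and i: "i < r" and a_le: "a i \<le> k" and t: "t \<le> a i"
    and sum: "(\<Sum>j<r. a j) + s = r * k" and s: "4 * s \<le> t" and k: "0 < k"
    and y: "y = real t / (4 * real r * real k)"
  shows "(\<Prod>j<r. (1 / skewed_weight r i y j) ^ (a(i := a i - t)) j)
    \<le> real r ^ (r * k - s - t) * exp (- (real t ^ 2 / (16 * real r * real k)))"
proof -
  define z where "z = (real r - 1) * y"
  define b where "b = (\<Sum>j\<in>{..<r} - {i}. a j)"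
  have z: "0 \<le> z" "z \<le> 1 / 2" and y0: "0 \<le> y" "y \<le> 1"
    using skewed_weight_small[OF r k _ y] a_le t by (auto simp: z_def)
  have inv_z: "1 / (1 - z) \<le> exp (z + 2 * z\<^sup>2)"
  proof -
    have "exp (- (z + 2 * z\<^sup>2)) \<le> 1 - z"
      using ln_one_minus_pos_lower_bound[of z] z by (simp add: ln_ge_iff)
    then have "inverse (1 - z) \<le> inverse (exp (- (z + 2 * z\<^sup>2)))"
      by (intro le_imp_inverse_le) auto
    then show ?thesis by (simp only: exp_minus inverse_inverse_eq inverse_eq_divide[of "1 - z"])
  qed
  have inv_y: "1 / (1 + y) \<le> exp (- (y - y\<^sup>2))"
  proof -
    have "exp (y - y\<^sup>2) \<le> 1 + y"
      using ln_one_plus_pos_lower_bound[of y] y0 by (simp add: ln_ge_iff)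
    then have "inverse (1 + y) \<le> inverse (exp (y - y\<^sup>2))"
      by (intro le_imp_inverse_le) auto
    then show ?thesis by (simp only: exp_minus inverse_eq_divide[of "1 + y"])
  qed
  have sum_a: "(\<Sum>j<r. a j) = a i + b" using i by (simp add: b_def sum.remove)
  then have exponent: "r * k - s - t = a i - t + b" using sum t by linarith
  have "(\<Prod>j<r. (1 / skewed_weight r i y j) ^ (a(i := a i - t)) j)
      = (real r / (1 - z)) ^ (a i - t) * (\<Prod>j\<in>{..<r} - {i}. (real r / (1 + y)) ^ a j)"
    using i by (simp add: prod.remove skewed_weight_def z_def)
  also have "(\<Prod>j\<in>{..<r} - {i}. (real r / (1 + y)) ^ a j) = (real r / (1 + y)) ^ b"
    by (simp add: b_def power_sum)
  also have "(real r / (1 - z)) ^ (a i - t) * (real r / (1 + y)) ^ b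
      = real r ^ (r * k - s - t) * ((1 / (1 - z)) ^ (a i - t) * (1 / (1 + y)) ^ b)"
    unfolding exponent by (simp add: power_add power_divide)
  also have "\<dots> \<le> real r ^ (r * k - s - t) * exp (- (real t ^ 2 / (16 * real r * real k)))"
  proof (intro mult_left_mono)
    \<comment> \<open>The base is at least 1, so the possibly smaller demand \<open>a i\<close> may
      be replaced by \<open>k\<close>.\<close>
    have "(1 / (1 - z)) ^ (a i - t) \<le> (1 / (1 - z)) ^ (k - t)"
      using z a_le by (intro power_increasing) auto
    also have "\<dots> \<le> exp (z + 2 * z\<^sup>2) ^ (k - t)"
      using z by (intro power_mono inv_z) auto
    also have "\<dots> = exp ((z + 2 * z\<^sup>2) * (real k - real t))"
      using t a_le by (simp add: exp_of_nat_mult[symmetric] of_nat_diff mult.commute)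
    finally have 1: "(1 / (1 - z)) ^ (a i - t) \<le> exp ((z + 2 * z\<^sup>2) * (real k - real t))" .
    have "(1 / (1 + y)) ^ b \<le> exp (- (y - y\<^sup>2)) ^ b"
      using y0 by (intro power_mono inv_y) auto
    also have "\<dots> = exp (- ((y - y\<^sup>2) * real b))"
      by (simp only: exp_of_nat_mult[symmetric]) (simp add: algebra_simps)
    finally have 2: "(1 / (1 + y)) ^ b \<le> exp (- ((y - y\<^sup>2) * real b))" .
    have "(real r - 1) * real k - real s \<le> real b"
    proof -
      have "real (a i + b + s) = real (r * k)" using sum sum_a by simp
      then show ?thesis using a_le by (simp add: algebra_simps)
    qed
    then have 3: "(z + 2 * z\<^sup>2) * (real k - real t) - (y - y\<^sup>2) * real b
        \<le> - (real t ^ 2 / (16 * real r * real k))"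
      using r k s y y0 z_def by (intro skewed_exponent_le) auto
    have "(1 / (1 - z)) ^ (a i - t) * (1 / (1 + y)) ^ b
        \<le> exp ((z + 2 * z\<^sup>2) * (real k - real t)) * exp (- ((y - y\<^sup>2) * real b))"
      using 1 2 z y0 by (intro mult_mono) auto
    also have "\<dots> = exp ((z + 2 * z\<^sup>2) * (real k - real t) - (y - y\<^sup>2) * real b)"
      by (simp only: exp_add[symmetric]) simp
    finally show "(1 / (1 - z)) ^ (a i - t) * (1 / (1 + y)) ^ b
        \<le> exp (- (real t ^ 2 / (16 * real r * real k)))"
      using 3 by (meson exp_le_cancel_iff order_trans)
  qed simp
  finally show ?thesis .
qed

section \<open>Choice of parameters\<close>

text \<open>The exponent required by \<open>book_exists\<close>, divided by \<open>t\<close>, for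
  \<delta> = 1 / \<kappa>^2.\<close>

definition book_cost :: "nat \<Rightarrow> nat \<Rightarrow> real"
  where "book_cost r \<kappa> = 2 * (geo_const r * real \<kappa> + ln (2 * real r)) * real r
    + 24 * real r ^ 2 * geo_const r * exp 2 * real \<kappa> * (2 + 2 * ln (real \<kappa>))"

text \<open>Bounds the boosts per spine vertex in the colour of the book, again for \<delta> = 1 /
  \<kappa>^2.\<close>

definition boost_density :: "nat \<Rightarrow> nat \<Rightarrow> real"
  where "boost_density r \<kappa> = 24 * real r * (2 + 2 * ln (real \<kappa>)) / real \<kappa> ^ 2"

text \<open>The size conditions belong to the stages: \<open>regular\<close> lets regularisation
  run, \<open>irregular\<close> settles the case of \<open>s0\<close> steps, \<open>cost\<close>
  supplies the reservoir, \<open>gain\<close> settles the case of a book. In \<open>gain\<close>,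
  each boost loses a factor r, and each of the t + b \<le> 2 t restrictions loses a further exp (- 4
  r \<delta>), since 1 / r - 2 \<delta> \<ge> exp (- 4 r \<delta>) / r.\<close>

lemma (in edge_colouring) has_clique_of_large:
  fixes \<kappa> t s0 k :: nat and \<delta> n :: real
  defines "\<delta> \<equiv> 1 / real \<kappa> ^ 2" and "n \<equiv> real (card V)"
  assumes kappa: "12 * r \<le> \<kappa>\<^sup>2" "\<kappa>\<^sup>2 \<le> 12 * r * t" "boost_density r \<kappa> \<le> 1"
    and t: "2 \<le> t" "4 * s0 \<le> t" "t + s0 \<le> k"
    and regular: "real r * real \<kappa> ^ 2 \<le> ((1 + \<delta>) / real r) ^ s0 * n"
    and irregular: "real r ^ (r * k) \<le> (1 + \<delta>) ^ s0 * n"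
    and cost: "exp (book_cost r \<kappa> * real t) \<le> ((1 + \<delta>) / real r) ^ s0 * n"
    and gain: "real r ^ (r * k) * exp (real t * (boost_density r \<kappa> * ln (real r) + 8 * real r * \<delta>)
      - real t ^ 2 / (16 * real r * real k)) \<le> n"
  shows "has_clique (\<lambda>_. k) V"
proof -
  have kappa_pos: "0 < \<kappa>" using kappa(1) r_ge_2 by (auto intro!: Nat.gr0I)
  have r: "2 \<le> real r" using r_ge_2 by simp
  have kappa_real: "12 * real r \<le> real \<kappa> ^ 2"
    using kappa(1) by (metis of_nat_le_iff of_nat_mult of_nat_numeral of_nat_power)
  have delta: "0 < \<delta>" "12 * real r * \<delta> \<le> 1"
    using kappa_real kappa_pos by (auto simp: \<delta>_def)
  have "1 * \<delta> \<le> 12 * real r * \<delta>" using r delta by (intro mult_right_mono) auto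
  then have delta_le: "\<delta> \<le> 1" using delta by linarith
  have ratio: "0 \<le> (1 + \<delta>) / real r" "(1 + \<delta>) / real r \<le> 1" using r delta delta_le by auto
  have regular': "real r / \<delta> \<le> ((1 + \<delta>) / real r) ^ s0 * real (card V)"
    using regular by (simp add: \<delta>_def n_def)
  have s0_le: "s0 \<le> k" using t by simp
  obtain s W a where s: "s \<le> s0" and WV: "W \<subseteq> V"
    and clique: "has_clique a W \<longrightarrow> has_clique (\<lambda>_. k) V"
    and a_bounds: "\<forall>i<r. a i \<le> k \<and> k \<le> a i + s" and sum_a: "(\<Sum>i<r. a i) + s = r * k"
    and card_W: "((1 + \<delta>) / real r) ^ s * real (card V) \<le> real (card W)"
    and stop: "s = s0 \<or> (\<forall>i<r. \<forall>x\<in>W. (1 / real r - \<delta>) * real (card W) \<le> real (card (nbhd i x \<inter> W)))"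
    by (rule regularise[OF delta(1) delta_le s0_le regular'])
  have a: "a i \<le> k" "k \<le> a i + s" if "i < r" for i
    using a_bounds that by blast+
  show ?thesis
  proof (cases "s = s0")
    case True
    have "has_clique a W"
    proof (rule erdos_szekeres[of "\<lambda>_. 1 / real r"])
      have "(\<Prod>i<r. (1 / (1 / real r)) ^ a i) = real r ^ (\<Sum>i<r. a i)"
        by (simp add: power_sum)
      also have "\<dots> = real r ^ (r * k) / real r ^ s"
        using r by (simp add: sum_a[symmetric] power_add)
      also have "\<dots> \<le> (1 + \<delta>) ^ s0 * n / real r ^ s"
        using irregular r by (intro divide_right_mono) auto
      also have "\<dots> \<le> real (card W)"
        using card_W by (simp add: True n_def power_divide)
      finally show "(\<Prod>i<r. (1 / (1 / real r)) ^ a i) \<le> real (card W)" .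
    qed (use r WV in auto)
    then show ?thesis using clique by blast
  next
    case False
    have "((1 + \<delta>) / real r) ^ s0 * n \<le> ((1 + \<delta>) / real r) ^ s * n"
      using ratio s by (intro mult_right_mono power_decreasing) (auto simp: n_def)
    then have "exp (book_cost r \<kappa> * real t) \<le> real (card W)"
      using cost card_W by (simp add: n_def)
    moreover from this have "0 < real (card W)" by (smt (verit) exp_gt_zero)
    then have W_nonempty: "W \<noteq> {}" by auto
    \<comment> \<open>The regular set serves as reservoir and as initial page set of every colour;
      for p = 1 / r - \<delta> the degree assumption is the stopping condition.\<close>
    interpret book: book_setup V r col W "\<lambda>_. W" "1 / real r - \<delta>" \<delta> t \<kappa>
    proof
      show "\<delta> < 1 / real r - \<delta>" using delta r by (simp add: field_simps)
    qed (use WV W_nonempty delta delta_le t kappa stop False in auto)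
    have max_gain: "book.max_gain = 2 + 2 * ln (real \<kappa>)"
      using kappa_pos unfolding book.max_gain_def by (simp add: \<delta>_def ln_div ln_realpow)
    have "2 * book.colour_cost * real r * real t + book.boost_cost * real r * book.max_gain
        = book_cost r \<kappa> * real t"
      using kappa_pos unfolding book.colour_cost_def book.boost_cost_def max_gain book_cost_def
      by (simp add: \<delta>_def field_simps power2_eq_square)
    ultimately have large: "exp (2 * book.colour_cost * real r * real t + book.boost_cost * real r * book.max_gain)
        \<le> real (card W)" by simp
    obtain i T Y b where i: "i < r" and T: "T \<subseteq> W" "card T = t" "mono_clique i T"
      and Y: "Y \<subseteq> W" "\<forall>x\<in>T. Y \<subseteq> nbhd i x"
      and b: "real b \<le> 24 * real r * real t * book.max_gain / real \<kappa> ^ 2"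
      and card_Y: "(1 / real r - \<delta> - \<delta>) ^ (t + b) * real (card W) \<le> real (card Y)"
      by (rule book.book_exists[OF large])
    have ti: "t \<le> a i" "0 < k" using a(2)[OF i] s t by linarith+
    define y where "y = real t / (4 * real r * real k)"
    have y: "0 \<le> (real r - 1) * y" "(real r - 1) * y \<le> 1 / 2" "0 \<le> y" "y \<le> 1"
      using skewed_weight_small[OF r_ge_2 ti(2) _ y_def] t by auto
    have "has_clique (a(i := a i - t)) Y"
    proof (rule erdos_szekeres[of "skewed_weight r i y"])
      show "0 < skewed_weight r i y j" if "j < r" for j
        using y r by (auto simp: skewed_weight_def)
      show "(\<Sum>j<r. skewed_weight r i y j) = 1" using i by (rule sum_skewed_weight)
      show "Y \<subseteq> V" using Y WV by blast
      define E where "E = boost_density r \<kappa> * ln (real r) + 8 * real r * \<delta>"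
      have b_le: "real b \<le> boost_density r \<kappa> * real t"
        using b by (simp add: max_gain boost_density_def mult_ac)
      also have "\<dots> \<le> 1 * real t" using kappa(3) by (intro mult_right_mono) auto
      finally have "real b \<le> real t" by simp
      have "real b * ln (real r) \<le> boost_density r \<kappa> * real t * ln (real r)"
        using b_le r by (intro mult_right_mono) auto
      moreover have "4 * real r * \<delta> * (real t + real b) \<le> 4 * real r * \<delta> * (real t + real t)"
        using \<open>real b \<le> real t\<close> delta by (intro mult_left_mono) auto
      ultimately have exponent: "- (real t * E) \<le> real (t + b) * (- 2 * (2 * real r * \<delta>)) - real b * ln (real r)"
        by (simp add: E_def algebra_simps)
      have "real r ^ (r * k) = real r ^ (r * k - s - t) * real r ^ (s + t)"
      proof -
        have "s + t \<le> r * k" using sum_a ti member_le_sum[of i "{..<r}" a] i by simp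
        then show ?thesis by (simp add: power_add[symmetric])
      qed
      then have "real r ^ (r * k - s - t) * exp (- (real t ^ 2 / (16 * real r * real k)))
          = real r ^ (r * k) * exp (real t * E - real t ^ 2 / (16 * real r * real k)) * exp (- (real t * E)) / real r ^ (s + t)"
        using r by (simp add: mult.assoc exp_add[symmetric])
      also have "\<dots> \<le> n * exp (- (real t * E)) / real r ^ (s + t)"
        using gain r by (intro divide_right_mono mult_right_mono) (auto simp: E_def)
      also have "\<dots> \<le> n * exp (real (t + b) * (- 2 * (2 * real r * \<delta>)) - real b * ln (real r)) / real r ^ (s + t)"
        using exponent r by (intro divide_right_mono mult_left_mono) (auto simp: n_def)
      also have "\<dots> = (exp (- 2 * (2 * real r * \<delta>)) / real r) ^ (t + b) * ((1 / real r) ^ s * n)"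
      proof -
        have "exp (real b * ln (real r)) = real r ^ b"
          using r by (simp add: exp_of_nat_mult)
        moreover have "exp (real (t + b) * (- 2 * (2 * real r * \<delta>))) = exp (- 2 * (2 * real r * \<delta>)) ^ (t + b)"
          by (rule exp_of_nat_mult)
        ultimately show ?thesis
          unfolding exp_diff power_divide power_add by (simp add: field_simps)
      qed
      also have "\<dots> \<le> (1 / real r - \<delta> - \<delta>) ^ (t + b) * real (card W)"
      proof (rule mult_mono)
        have "exp (- 2 * (2 * real r * \<delta>)) \<le> 1 - 2 * real r * \<delta>"
          using delta r by (intro exp_minus_double_le) auto
        then have "exp (- 2 * (2 * real r * \<delta>)) / real r \<le> (1 - 2 * real r * \<delta>) / real r"
          using r by (intro divide_right_mono) auto
        also have "\<dots> = 1 / real r - \<delta> - \<delta>" using r by (simp add: field_simps)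
        finally show pow: "(exp (- 2 * (2 * real r * \<delta>)) / real r) ^ (t + b) \<le> (1 / real r - \<delta> - \<delta>) ^ (t + b)"
          by (intro power_mono) auto
        then show "0 \<le> (1 / real r - \<delta> - \<delta>) ^ (t + b)"
          by (rule order_trans[rotated]) simp
        have "(1 / real r) ^ s * n \<le> ((1 + \<delta>) / real r) ^ s * n"
          using delta r by (intro mult_right_mono power_mono divide_right_mono) (auto simp: n_def)
        then show "(1 / real r) ^ s * n \<le> real (card W)" using card_W by (simp add: n_def)
      qed (simp add: n_def)
      also have "\<dots> \<le> real (card Y)" by (rule card_Y)
      finally have "real r ^ (r * k - s - t) * exp (- (real t ^ 2 / (16 * real r * real k))) \<le> real (card Y)" .
      then show "(\<Prod>j<r. (1 / skewed_weight r i y j) ^ (a(i := a i - t)) j) \<le> real (card Y)"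
        using prod_skewed_weight_le[OF r_ge_2 i a(1)[OF i] ti(1) sum_a _ ti(2) y_def] s t by linarith
    qed
    then have clique_Y: "has_clique (a(i := a i - card T)) Y" using T by simp
    have "Y \<subseteq> nbhd i x" if "x \<in> T" for x using Y(2) that by blast
    then have "has_clique a W"
      by (rule has_clique_extend[OF clique_Y i T(3,1) Y(1) WV])
    then show ?thesis using clique by blast
  qed
qed

text \<open>With \<open>t = k / (2 * book_cost)\<close>, the left side is the loss per spine vertex and the right side is
  of the order of the gain \<open>t / (r * k)\<close>; up to logarithms they are \<open>\<kappa>\<^sup>-\<^sup>2\<close> and \<open>\<kappa>\<^sup>-\<^sup>1\<close>.\<close>
lemma exists_good_density:
  assumes r: "2 \<le> r"
  shows "\<exists>\<kappa>. 12 * r \<le> \<kappa>\<^sup>2 \<and> boost_density r \<kappa> \<le> 1 \<and> 1 \<le> book_cost r \<kappa>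
    \<and> boost_density r \<kappa> * ln (real r) + 8 * real r * (1 / real \<kappa> ^ 2) \<le> 1 / (128 * real r * book_cost r \<kappa>)"
proof -
  define A B C D where "A = 2 * geo_const r * real r" and "B = 2 * ln (2 * real r) * real r"
    and "C = 24 * real r ^ 2 * geo_const r * exp 2" and "D = 24 * real r"
  have pos: "0 < A" "0 < B" "0 < C" "0 < D" "0 < real r" "0 < ln (real r)"
    using r geo_const_ge_1[of r] by (auto simp: A_def B_def C_def D_def)
  have cost: "book_cost r \<kappa> = A * real \<kappa> + B + C * real \<kappa> * (2 + 2 * ln (real \<kappa>))" for \<kappa>
    by (simp add: book_cost_def A_def B_def C_def algebra_simps)
  have density: "boost_density r \<kappa> = D * (2 + 2 * ln (real \<kappa>)) / real \<kappa> ^ 2" for \<kappa>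
    by (simp add: boost_density_def D_def)
  have "(\<lambda>\<kappa>. D * (2 + 2 * ln (real \<kappa>)) / real \<kappa> ^ 2) \<longlonglongrightarrow> 0"
    by real_asymp
  then have 1: "eventually (\<lambda>\<kappa>. boost_density r \<kappa> < 1) sequentially"
    unfolding density by (rule order_tendstoD) simp
  have "(\<lambda>\<kappa>. (D * (2 + 2 * ln (real \<kappa>)) / real \<kappa> ^ 2 * ln (real r) + 8 * real r * (1 / real \<kappa> ^ 2))
      * (A * real \<kappa> + B + C * real \<kappa> * (2 + 2 * ln (real \<kappa>)))) \<longlonglongrightarrow> 0"
    using pos by real_asymp
  then have 2: "eventually (\<lambda>\<kappa>. (boost_density r \<kappa> * ln (real r) + 8 * real r * (1 / real \<kappa> ^ 2)) * book_cost r \<kappa>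
      < 1 / (128 * real r)) sequentially"
    unfolding cost density using pos by (intro order_tendstoD) auto
  have "filterlim (\<lambda>\<kappa>. A * real \<kappa> + B + C * real \<kappa> * (2 + 2 * ln (real \<kappa>))) at_top sequentially"
    using pos by real_asymp
  then have 3: "eventually (\<lambda>\<kappa>. 1 \<le> book_cost r \<kappa>) sequentially"
    unfolding cost filterlim_at_top by blast
  have 4: "eventually (\<lambda>\<kappa>. 12 * r \<le> \<kappa>) sequentially" by (rule eventually_ge_at_top)
  from eventually_conj[OF eventually_conj[OF 1 2] eventually_conj[OF 3 4]]
  obtain \<kappa> where k: "boost_density r \<kappa> < 1"
    "(boost_density r \<kappa> * ln (real r) + 8 * real r * (1 / real \<kappa> ^ 2)) * book_cost r \<kappa> < 1 / (128 * real r)"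
    "1 \<le> book_cost r \<kappa>" "12 * r \<le> \<kappa>"
    unfolding eventually_sequentially by blast
  have "12 * r \<le> \<kappa>\<^sup>2" using k(4) self_le_power[of \<kappa> 2] r by linarith
  moreover have "boost_density r \<kappa> * ln (real r) + 8 * real r * (1 / real \<kappa> ^ 2) \<le> 1 / (128 * real r * book_cost r \<kappa>)"
    unfolding divide_divide_eq_left[symmetric] using k(2,3) by (subst pos_le_divide_eq) linarith+
  ultimately show ?thesis using k by (meson less_imp_le)
qed

lemma ex_clique_exponent:
  assumes r: "2 \<le> r"
  shows "\<exists>\<delta>::real. \<delta> > 0 \<and> (\<forall>\<^sub>F k in sequentially. \<forall>(V :: 'a set) col. edge_colouring V r col \<longrightarrow>
    exp (- \<delta> * real k) * real r ^ (r * k) \<le> real (card V) \<longrightarrow> edge_colouring.has_clique r col (\<lambda>_. k) V)"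
proof -
  obtain \<kappa> where kappa: "12 * r \<le> \<kappa>\<^sup>2" "boost_density r \<kappa> \<le> 1" "1 \<le> book_cost r \<kappa>"
    and density: "boost_density r \<kappa> * ln (real r) + 8 * real r * (1 / real \<kappa> ^ 2) \<le> 1 / (128 * real r * book_cost r \<kappa>)"
    using exists_good_density[OF r] by blast
  have kappa_pos: "0 < \<kappa>" using kappa(1) r by (auto intro!: Nat.gr0I)
  define \<epsilon> where "\<epsilon> = 1 / real \<kappa> ^ 2"
  have eps: "0 < \<epsilon>" using kappa_pos by (simp add: \<epsilon>_def)
  \<comment> \<open>With this choice a spine of \<tau> k vertices needs a reservoir of size only exp
    (k / 2).\<close>
  define \<tau> where "\<tau> = 1 / (2 * book_cost r \<kappa>)"
  have tau: "0 < \<tau>" "\<tau> \<le> 1 / 2" "book_cost r \<kappa> * \<tau> = 1 / 2"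
    using kappa(3) by (auto simp: \<tau>_def)
  define Q where "Q = boost_density r \<kappa> * ln (real r) + 8 * real r * \<epsilon>"
  have Q: "Q \<le> \<tau> / (64 * real r)"
    using density by (simp add: Q_def \<epsilon>_def \<tau>_def mult_ac)
  \<comment> \<open>The three bounds come from the saving of a book, from the gain (1 +
    \<epsilon>)^s0 of the irregular case with s0 \<ge> \<tau> k / 16, and from the wish to keep at
    least exp (k / 2) vertices after \<open>s0\<close> steps.\<close>
  define \<delta> where "\<delta> = min (min (\<tau>\<^sup>2 / (128 * real r)) (\<tau> * ln (1 + \<epsilon>) / 16)) (1 / 4)"
  have delta: "0 < \<delta>" "\<delta> \<le> \<tau>\<^sup>2 / (128 * real r)" "\<delta> \<le> \<tau> * ln (1 + \<epsilon>) / 16" "\<delta> \<le> 1 / 4"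
    using tau eps r by (auto simp: \<delta>_def)
  have r2: "2 \<le> real r" using r by simp
  have "\<forall>\<^sub>F k in sequentially. 16 \<le> \<tau> * real k \<and> real \<kappa> ^ 2 \<le> \<tau> * real k \<and> real r * real \<kappa> ^ 2 \<le> exp (real k / 2)"
  proof (intro eventually_conj)
    have "filterlim (\<lambda>k. \<tau> * real k) at_top sequentially" using tau(1) by real_asymp
    then show "\<forall>\<^sub>F k in sequentially. 16 \<le> \<tau> * real k" "\<forall>\<^sub>F k in sequentially. real \<kappa> ^ 2 \<le> \<tau> * real k"
      unfolding filterlim_at_top by blast+
    have "filterlim (\<lambda>k. exp (real k / 2)) at_top sequentially" by real_asymp
    then show "\<forall>\<^sub>F k in sequentially. real r * real \<kappa> ^ 2 \<le> exp (real k / 2)"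
      unfolding filterlim_at_top by blast
  qed
  then have "\<forall>\<^sub>F k in sequentially. \<forall>(V :: 'a set) col. edge_colouring V r col \<longrightarrow>
    exp (- \<delta> * real k) * real r ^ (r * k) \<le> real (card V) \<longrightarrow> edge_colouring.has_clique r col (\<lambda>_. k) V"
  proof (rule eventually_mono, intro allI impI)
    fix k :: nat and V :: "'a set" and col
    assume k: "16 \<le> \<tau> * real k \<and> real \<kappa> ^ 2 \<le> \<tau> * real k \<and> real r * real \<kappa> ^ 2 \<le> exp (real k / 2)"
      and colouring: "edge_colouring V r col"
      and card: "exp (- \<delta> * real k) * real r ^ (r * k) \<le> real (card V)"
    define t where "t = nat \<lfloor>\<tau> * real k\<rfloor>"
    \<comment> \<open>Still linear in \<open>k\<close>, yet small enough for 4 s0 \<le> t, which the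
      skewed weights require.\<close>
    define s0 where "s0 = t div 4"
    have t: "real t \<le> \<tau> * real k" "\<tau> * real k - 1 \<le> real t"
      using k unfolding t_def by linarith+
    have s0: "4 * s0 \<le> t" "t \<le> 4 * s0 + 3" unfolding s0_def by linarith+
    have s0_ge: "\<tau> * real k / 16 \<le> real s0"
    proof -
      have "real t \<le> real (4 * s0 + 3)" using s0(2) by (simp only: of_nat_le_iff)
      then show ?thesis using t k by simp
    qed
    have "\<tau> * real k \<le> 1 / 2 * real k" using tau by (intro mult_right_mono) auto
    then have t_le: "2 * real t \<le> real k" using t by linarith
    have k_pos: "0 < real k" using k tau by (smt (verit) mult_nonneg_nonpos)
    have ln_r: "1 / 2 \<le> ln (real r)"
    proof -
      have "exp 1 \<le> (2::real) ^ 2" using exp_le by simp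
      also have "\<dots> \<le> real r ^ 2" using r2 by (intro power_mono) auto
      finally have "1 \<le> ln (real r ^ 2)" using r2 by (simp add: ln_ge_iff)
      then show ?thesis using r2 by (simp add: ln_realpow)
    qed
    have pow_r: "real r ^ m = exp (real m * ln (real r))" for m
      using r2 by (simp add: exp_of_nat_mult)
    have card_exp: "exp (real (r * k) * ln (real r) - \<delta> * real k) \<le> real (card V)"
      using card unfolding pow_r exp_add[symmetric] by (simp add: add.commute)
    have base: "exp (real k / 2) \<le> ((1 + \<epsilon>) / real r) ^ s0 * real (card V)"
    proof -
      have "15 / 8 * real k \<le> real (r * k) - real s0"
      proof -
        have "2 * real k \<le> real r * real k" using r2 by (intro mult_right_mono) auto
        moreover have "4 * real s0 \<le> real t" using s0(1) by linarith
        ultimately show ?thesis using t_le by simp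
      qed
      then have "15 / 8 * real k * (1 / 2) \<le> (real (r * k) - real s0) * ln (real r)"
        using ln_r k_pos by (intro mult_mono) auto
      moreover have "\<delta> * real k \<le> 1 / 4 * real k" using delta by (intro mult_right_mono) auto
      ultimately have "real k / 2 \<le> real (r * k) * ln (real r) - \<delta> * real k - real s0 * ln (real r)"
        by (simp add: algebra_simps)
      then have "exp (real k / 2) \<le> exp (real (r * k) * ln (real r) - \<delta> * real k) / exp (real s0 * ln (real r))"
        unfolding exp_diff[symmetric] by simp
      also have "\<dots> \<le> real (card V) / real r ^ s0"
        unfolding pow_r by (intro divide_right_mono card_exp) simp
      also have "\<dots> = (1 / real r) ^ s0 * real (card V)" by (simp add: power_divide)
      also have "\<dots> \<le> ((1 + \<epsilon>) / real r) ^ s0 * real (card V)"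
        using eps r2 by (intro mult_right_mono power_mono divide_right_mono) auto
      finally show ?thesis .
    qed
    interpret edge_colouring V r col by (rule colouring)
    show "has_clique (\<lambda>_. k) V"
    proof (rule has_clique_of_large[of \<kappa> t s0], unfold \<epsilon>_def[symmetric] Q_def[symmetric])
      have "real \<kappa> ^ 2 \<le> real t + 1" "2 \<le> real t" using k t by linarith+
      then have "real \<kappa> ^ 2 \<le> 2 * real t" by linarith
      also have "2 * real t \<le> 12 * real r * real t" using r2 by (intro mult_right_mono) auto
      finally have "real (\<kappa>\<^sup>2) \<le> real (12 * r * t)" by simp
      then show "\<kappa>\<^sup>2 \<le> 12 * r * t" by (simp only: of_nat_le_iff)
      show "2 \<le> t" using \<open>2 \<le> real t\<close> by simp
      show "t + s0 \<le> k" using t_le s0(1) by linarith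
      show "real r * real \<kappa> ^ 2 \<le> ((1 + \<epsilon>) / real r) ^ s0 * real (card V)"
        using k base by linarith
      have "book_cost r \<kappa> * real t \<le> book_cost r \<kappa> * (\<tau> * real k)"
        using t kappa(3) by (intro mult_left_mono) auto
      also have "\<dots> = real k / 2" using tau(3) by (simp add: mult.assoc[symmetric])
      finally have "book_cost r \<kappa> * real t \<le> real k / 2" .
      then show "exp (book_cost r \<kappa> * real t) \<le> ((1 + \<epsilon>) / real r) ^ s0 * real (card V)"
        using base by (meson exp_le_cancel_iff order_trans)
      have "\<delta> * real k \<le> \<tau> * ln (1 + \<epsilon>) / 16 * real k" using delta by (intro mult_right_mono) auto
      also have "\<dots> = \<tau> * real k / 16 * ln (1 + \<epsilon>)" by simp
      also have "\<dots> \<le> real s0 * ln (1 + \<epsilon>)" using eps s0_ge by (intro mult_right_mono) auto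
      finally have "exp (\<delta> * real k) \<le> exp (real s0 * ln (1 + \<epsilon>))" by simp
      also have "\<dots> = (1 + \<epsilon>) ^ s0" using eps by (simp add: exp_of_nat_mult)
      finally have "exp (\<delta> * real k) * exp (real (r * k) * ln (real r) - \<delta> * real k) \<le> (1 + \<epsilon>) ^ s0 * real (card V)"
        using eps by (intro mult_mono card_exp) auto
      then show "real r ^ (r * k) \<le> (1 + \<epsilon>) ^ s0 * real (card V)"
        unfolding pow_r exp_add[symmetric] by simp
      have t_half: "\<tau> * real k / 2 \<le> real t" using k t by linarith
      \<comment> \<open>The saving t^2 / (16 r k) is at least twice \<tau> t / (64 r). The loss t Q
        uses up at most one of these halves, and the other is at least \<delta> k.\<close>
      have "real t * Q - real t ^ 2 / (16 * real r * real k) \<le> - \<delta> * real k"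
      proof -
        have "real t * Q \<le> real t * (\<tau> / (64 * real r))" using Q by (intro mult_left_mono) auto
        moreover have "real t * (\<tau> * real k / 2) / (16 * real r * real k) \<le> real t * real t / (16 * real r * real k)"
          using t_half by (intro divide_right_mono mult_left_mono) auto
        moreover have "real t * (\<tau> * real k / 2) / (16 * real r * real k) = real t * (\<tau> / (64 * real r)) + real t * (\<tau> / (64 * real r))"
          using k_pos r2 by (simp add: field_simps)
        moreover have "\<tau> * real k / 2 * (\<tau> / (64 * real r)) \<le> real t * (\<tau> / (64 * real r))"
          using t_half tau r2 by (intro mult_right_mono) auto
        moreover have "\<tau> * real k / 2 * (\<tau> / (64 * real r)) = \<tau>\<^sup>2 / (128 * real r) * real k"
          by (simp add: power2_eq_square)
        moreover have "\<delta> * real k \<le> \<tau>\<^sup>2 / (128 * real r) * real k"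
          using delta by (intro mult_right_mono) auto
        ultimately show ?thesis unfolding power2_eq_square[of "real t"] by linarith
      qed
      then have "exp (real (r * k) * ln (real r) + (real t * Q - real t ^ 2 / (16 * real r * real k)))
          \<le> exp (real (r * k) * ln (real r) - \<delta> * real k)" by simp
      then show "real r ^ (r * k) * exp (real t * Q - real t ^ 2 / (16 * real r * real k)) \<le> real (card V)"
        unfolding pow_r exp_add[symmetric] using card_exp by linarith
    qed (use kappa s0 in auto)
  qed
  then show ?thesis using delta(1) by blast
qed

section \<open>From large vertex sets to the Ramsey number\<close>

lemma partn_of_clique:
  assumes r: "2 \<le> r"
    and clique: "\<And>col. edge_colouring {..<n::nat} r col \<Longrightarrow> edge_colouring.has_clique r col (\<lambda>_. k) {..<n}"
  shows "partn {..<n} k 2 {..<r}"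
  unfolding partn_def monochromatic_def
proof
  fix f
  assume f: "f \<in> nsets {..<n} 2 \<rightarrow> {..<r}"
  define col where "col x y = f {x, y}" for x y :: nat
  interpret edge_colouring "{..<n}" r col
  proof
    show "col x y = col y x" for x y by (simp add: col_def insert_commute)
    show "col x y < r" if "x \<in> {..<n}" "y \<in> {..<n}" "x \<noteq> y" for x y
    proof -
      have "{x, y} \<in> nsets {..<n} 2" using that by (auto simp: nsets_2_eq)
      then show ?thesis using f by (auto simp: col_def)
    qed
  qed (use r in auto)
  have "has_clique (\<lambda>_. k) {..<n}"
    by (rule clique) (rule edge_colouring_axioms)
  then obtain i A where i: "i < r" "A \<subseteq> {..<n}" "card A = k" "mono_clique i A"
    unfolding has_clique_def by blast
  then have "f ` nsets A 2 \<subseteq> {i}"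
    by (auto simp: mono_clique_def col_def nsets_2_eq)
  moreover have "A \<in> nsets {..<n} k" using i finite_subset by (auto simp: nsets_def)
  ultimately show "\<exists>\<xi>\<in>{..<r}. \<exists>H\<in>nsets {..<n} k. f ` nsets H 2 \<subseteq> {\<xi>}" using i by blast
qed

theorem theorem1p1:
  fixes r :: nat
  assumes "r \<ge> 2"
  shows "\<exists>\<delta>::real. \<delta> > 0 \<and>
    (\<forall>\<^sub>F k in sequentially. real (ramsey_number r k) \<le> exp (- \<delta> * real k) * real r ^ (r * k))"
proof -
  obtain \<delta> :: real where delta: "\<delta> > 0"
    and ev: "\<forall>\<^sub>F k in sequentially. \<forall>(V :: nat set) col. edge_colouring V r col \<longrightarrow>
    exp (- \<delta> * real k) * real r ^ (r * k) \<le> real (card V) \<longrightarrow> edge_colouring.has_clique r col (\<lambda>_. k) V"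
    using ex_clique_exponent[OF assms] by blast
  \<comment> \<open>Half of this exponent will pay for the factor 2 lost by rounding x up to an
    integer; that factor suffices once x \<ge> 1, which the cap 1 ensures.\<close>
  define \<delta>' where "\<delta>' = min \<delta> 1"
  have delta': "0 < \<delta>'" "\<delta>' \<le> \<delta>" "\<delta>' \<le> 1" using delta by (auto simp: \<delta>'_def)
  have "filterlim (\<lambda>k. exp (\<delta>' / 2 * real k)) at_top sequentially"
    using delta' by real_asymp
  then have "\<forall>\<^sub>F k in sequentially. 2 \<le> exp (\<delta>' / 2 * real k)"
    unfolding filterlim_at_top by blast
  with ev have "\<forall>\<^sub>F k in sequentially. real (ramsey_number r k) \<le> exp (- (\<delta>' / 2) * real k) * real r ^ (r * k)"
  proof eventually_elim
    case (elim k)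
    define x where "x = exp (- \<delta>' * real k) * real r ^ (r * k)"
    define n where "n = nat \<lceil>x\<rceil>"
    have "1 \<le> x"
    proof -
      have "exp (\<delta>' * real k) \<le> exp (1 * real k)"
        using delta' by (subst exp_le_cancel_iff, intro mult_right_mono) auto
      also have "\<dots> = exp 1 ^ k" by (simp add: exp_of_nat_mult[symmetric])
      also have "\<dots> \<le> (real r ^ r) ^ k"
      proof (rule power_mono)
        have "exp 1 \<le> (2::real) ^ 2" using exp_le by simp
        also have "\<dots> \<le> real r ^ 2" using assms by (intro power_mono) auto
        also have "\<dots> \<le> real r ^ r" using assms by (intro power_increasing) auto
        finally show "exp 1 \<le> real r ^ r" .
      qed simp
      also have "\<dots> = real r ^ (r * k)" by (simp add: power_mult)
      finally show ?thesis by (simp add: x_def exp_minus field_simps)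
    qed
    have n: "x \<le> real n" "real n \<le> 2 * x" using \<open>1 \<le> x\<close> unfolding n_def by linarith+
    have "exp (- \<delta> * real k) * real r ^ (r * k) \<le> x"
      using delta' unfolding x_def by (intro mult_right_mono) (auto simp: mult_right_mono)
    then have "exp (- \<delta> * real k) * real r ^ (r * k) \<le> real (card {..<n})" using n by simp
    then have "partn {..<n} k 2 {..<r}"
      using elim(1) by (intro partn_of_clique assms) blast
    then have "ramsey_number r k \<le> n" unfolding ramsey_number_def by (rule Least_le)
    then have "real (ramsey_number r k) \<le> 2 * x" using n by linarith
    also have "\<dots> \<le> exp (\<delta>' / 2 * real k) * x"
      using elim(2) \<open>1 \<le> x\<close> by (intro mult_right_mono) auto
    also have "\<dots> = exp (- (\<delta>' / 2) * real k) * real r ^ (r * k)"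
      unfolding x_def mult.assoc[symmetric] exp_add[symmetric] by simp
    finally show ?case .
  qed
  then show ?thesis using delta' by (intro exI[of _ "\<delta>' / 2"]) simp
qed

end
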